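(* Let $X$ be an edge-end space, i.e. a topological space homeomorphic to $\Omega_E(G)$ for some connected graph $G$. Then the following are equivalent: (1) $X$ is first countable; (2) $X$ is metrizable; (3) $X$ is completely ultrametrizable; (4) $X$ is homeomorphic to the end space $\Omega(T)=\Omega_E(T)$ of some graph-theoretic tree $T$.
   Context: Graphs may be infinite. A ray is a one-way infinite path. Two rays of a graph $G=(V,E)$ are edge-equivalent if no finite set of edges separates them; the equivalence classes are the edge-ends of $G$, forming the set $\Omega_E(G)$. A region of $G$ is a connected induced subgraph $C$ whose boundary $\partial C=\{xy\in E: x\in C, y\notin C\}$ is finite (e.g. any component of $G-F$ for a finite $F\subseteq E$). For a region $C$, $\Omega_E(C)$ is the set of edge-ends having a ray contained in $C$ (equivalently, all of whose rays have a tail in $C$). The sets $\Omega_E(C)$, $C$ a region of $G$, form a basis of the topology of the edge-end space $\Omega_E(G)$. For a tree $T$, vertex-equivalence (no finite vertex set separates the rays) and edge-equivalence coincide, so the end space $\Omega(T)$ equals $\Omega_E(T)$ with this topology. *)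

theory Defs
  imports "HOL-Analysis.Analysis"
begin

definition graph :: "'v set \<Rightarrow> 'v set set \<Rightarrow> bool" where
  "graph V E \<longleftrightarrow> (\<forall>e\<in>E. \<exists>x y. x \<noteq> y \<and> e = {x, y} \<and> x \<in> V \<and> y \<in> V)"

definition walk :: "'v set set \<Rightarrow> 'v list \<Rightarrow> bool" where
  "walk E xs \<longleftrightarrow> xs \<noteq> [] \<and> (\<forall>i. Suc i < length xs \<longrightarrow> {xs ! i, xs ! Suc i} \<in> E)"

definition reachable :: "'v set set \<Rightarrow> 'v \<Rightarrow> 'v \<Rightarrow> bool" where
  "reachable E x y \<longleftrightarrow> (\<exists>xs. walk E xs \<and> hd xs = x \<and> last xs = y)"

definition connected_graph :: "'v set \<Rightarrow> 'v set set \<Rightarrow> bool" where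
  "connected_graph V E \<longleftrightarrow> graph V E \<and> V \<noteq> {} \<and> (\<forall>x\<in>V. \<forall>y\<in>V. reachable E x y)"

definition has_cycle :: "'v set set \<Rightarrow> bool" where
  "has_cycle E \<longleftrightarrow> (\<exists>xs. length xs \<ge> 3 \<and> distinct xs \<and> walk E xs \<and> {last xs, hd xs} \<in> E)"

definition tree :: "'v set \<Rightarrow> 'v set set \<Rightarrow> bool" where
  "tree V E \<longleftrightarrow> connected_graph V E \<and> \<not> has_cycle E"

definition ray :: "'v set \<Rightarrow> 'v set set \<Rightarrow> (nat \<Rightarrow> 'v) \<Rightarrow> bool" where
  "ray V E r \<longleftrightarrow> inj r \<and> (\<forall>n. r n \<in> V) \<and> (\<forall>n. {r n, r (Suc n)} \<in> E)"

definition edge_equiv :: "'v set set \<Rightarrow> (nat \<Rightarrow> 'v) \<Rightarrow> (nat \<Rightarrow> 'v) \<Rightarrow> bool" where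
  "edge_equiv E r s \<longleftrightarrow>
     (\<forall>F. F \<subseteq> E \<and> finite F \<longrightarrow>
        (\<exists>m n. \<forall>i\<ge>m. \<forall>j\<ge>n. reachable (E - F) (r i) (s j)))"

definition edge_ends :: "'v set \<Rightarrow> 'v set set \<Rightarrow> (nat \<Rightarrow> 'v) set set" where
  "edge_ends V E = {{s. ray V E s \<and> edge_equiv E r s} | r. ray V E r}"

definition edge_boundary :: "'v set set \<Rightarrow> 'v set \<Rightarrow> 'v set set" where
  "edge_boundary E C = {e \<in> E. e \<inter> C \<noteq> {} \<and> \<not> e \<subseteq> C}"

definition region :: "'v set \<Rightarrow> 'v set set \<Rightarrow> 'v set \<Rightarrow> bool" where
  "region V E C \<longleftrightarrow> C \<subseteq> V \<and> C \<noteq> {} \<and>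
     (\<forall>x\<in>C. \<forall>y\<in>C. reachable {e \<in> E. e \<subseteq> C} x y) \<and> finite (edge_boundary E C)"

definition ends_in :: "'v set \<Rightarrow> 'v set set \<Rightarrow> 'v set \<Rightarrow> (nat \<Rightarrow> 'v) set set" where
  "ends_in V E C = {\<omega> \<in> edge_ends V E. \<exists>r\<in>\<omega>. \<forall>n. r n \<in> C}"

definition edge_end_space :: "'v set \<Rightarrow> 'v set set \<Rightarrow> (nat \<Rightarrow> 'v) set topology" where
  "edge_end_space V E = topology (\<lambda>U. U \<subseteq> edge_ends V E \<and>
      (\<forall>\<omega>\<in>U. \<exists>C. region V E C \<and> \<omega> \<in> ends_in V E C \<and> ends_in V E C \<subseteq> U))"

definition completely_ultrametrizable_space :: "'a topology \<Rightarrow> bool" where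
  "completely_ultrametrizable_space X \<longleftrightarrow>
     (\<exists>M d. Metric_space M d \<and> Metric_space.mcomplete M d \<and>
        (\<forall>x\<in>M. \<forall>y\<in>M. \<forall>z\<in>M. d x z \<le> max (d x y) (d y z)) \<and>
        X = Metric_space.mtopology M d)"

end

theory Submission
  imports Defs
begin

text \<open>
  The substantial implication is from first countability to complete ultrametrizability. The finite
  cuts of the graph determine the topology. Given a finite vertex set \<open>Y\<close>, submodularity of the cut
  size lets one uncross minimum cuts that separate ends from \<open>Y\<close>; exhausting the cut sizes
  \<open>k = 1, 2, \<dots>\<close> with Zorn's lemma yields disjoint finite cuts avoiding \<open>Y\<close> which capture every end not
  dominated by \<open>Y\<close>. Only finitely many ends are dominated by \<open>Y\<close>, and each of them is split off along
  a countable neighbourhood base. Iterating, with \<open>Y\<close> absorbing the boundaries of the cuts found so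
  far, gives a refining sequence of clopen partitions. A decreasing sequence of parts converges:
  either it follows the base of a dominated end, or it contains regions whose boundaries are pairwise
  disjoint, whose intersection is therefore empty, and which carry exactly one end. Conversely, the
  balls of a complete ultrametric form a tree whose ends are the points of the space, and in a tree
  the components of \<open>T - e\<close>, with \<open>e\<close> running along a ray, form a countable base at its end.
\<close>

section \<open>Finite cuts and edge-ends\<close>

text \<open>Regions are replaced by arbitrary vertex sets with finite boundary. These form a Boolean
  algebra on which every end acts as an ultrafilter, whereas an intersection of regions may be
  disconnected. Connectedness is restored by passing to components, for two reasons: a connected set
  that misses the endpoints of a finite boundary lies on one side of it, and a ray can be routed
  through a decreasing sequence of connected sets. First countability matters at dominated ends.
  Such an end cannot be cut off from the vertices dominating it, so no sequence of cuts avoiding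
  more and more vertices shrinks to it, and its base has to come from the hypothesis. Zorn's lemma
  is applied for one bound \<open>k\<close> at a time, since the union of a chain of cuts is sure to
  have a finite boundary only under a uniform bound on their sizes. Minimality with respect to one
  end per cut makes crossings both finite in number and removable.\<close>

definition arcs :: "'v set set \<Rightarrow> ('v \<times> 'v) set" where
  "arcs F = {(a, b). {a, b} \<in> F}"

section \<open>Reachability as a reflexive transitive closure\<close>

lemma walk_Cons_Cons: "walk F (x # y # zs) \<longleftrightarrow> {x, y} \<in> F \<and> walk F (y # zs)"
proof
  assume w: "walk F (x # y # zs)"
  have "{x, y} \<in> F"
    using w unfolding walk_def by force
  moreover have "{(y # zs) ! i, (y # zs) ! Suc i} \<in> F" if "Suc i < length (y # zs)" for i
    using w that unfolding walk_def by (metis Suc_less_eq length_Cons nth_Cons_Suc)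
  ultimately show "{x, y} \<in> F \<and> walk F (y # zs)"
    unfolding walk_def by blast
next
  assume w: "{x, y} \<in> F \<and> walk F (y # zs)"
  have "{(x # y # zs) ! i, (x # y # zs) ! Suc i} \<in> F" if "Suc i < length (x # y # zs)" for i
    using w that unfolding walk_def by (cases i) auto
  then show "walk F (x # y # zs)"
    unfolding walk_def by blast
qed

lemma walk_singleton [simp]: "walk F [x]"
  by (simp add: walk_def)

lemma reachable_iff_rtrancl: "reachable F x y \<longleftrightarrow> (x, y) \<in> (arcs F)\<^sup>*"
proof
  have "walk F xs \<Longrightarrow> (hd xs, last xs) \<in> (arcs F)\<^sup>*" for xs
  proof (induction xs rule: induct_list012)
    case (3 x y zs)
    then have "(x, y) \<in> arcs F" "(y, last (y # zs)) \<in> (arcs F)\<^sup>*"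
      by (auto simp: walk_Cons_Cons arcs_def)
    then show ?case
      by (simp add: converse_rtrancl_into_rtrancl)
  qed (auto simp: walk_def)
  then show "reachable F x y \<Longrightarrow> (x, y) \<in> (arcs F)\<^sup>*"
    by (auto simp: reachable_def)
next
  assume "(x, y) \<in> (arcs F)\<^sup>*"
  then show "reachable F x y"
  proof (induction rule: converse_rtrancl_induct)
    case base
    show ?case
      unfolding reachable_def by (rule exI[of _ "[y]"]) simp
  next
    case (step a b)
    then obtain xs where xs: "walk F xs" "hd xs = b" "last xs = y"
      unfolding reachable_def by blast
    then obtain zs where zs: "xs = b # zs"
      by (metis hd_Cons_tl walk_def)
    have "walk F (a # b # zs)" "last (a # b # zs) = y"
      using xs zs step by (auto simp: walk_Cons_Cons arcs_def)
    then show ?case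
      unfolding reachable_def by (intro exI[of _ "a # b # zs"]) simp
  qed
qed

lemma reachable_refl [simp]: "reachable F x x"
  by (simp add: reachable_iff_rtrancl)

lemma reachable_trans: "reachable F x y \<Longrightarrow> reachable F y z \<Longrightarrow> reachable F x z"
  unfolding reachable_iff_rtrancl by (rule rtrancl_trans)

lemma reachable_edge: "{x, y} \<in> F \<Longrightarrow> reachable F x y"
  unfolding reachable_iff_rtrancl by (auto simp: arcs_def)

lemma reachable_step: "reachable F x y \<Longrightarrow> {y, z} \<in> F \<Longrightarrow> reachable F x z"
  by (blast intro: reachable_trans reachable_edge)

lemma reachable_sym: "reachable F x y \<Longrightarrow> reachable F y x"
proof -
  have "sym (arcs F)"
    by (auto simp: sym_def arcs_def insert_commute)
  then show "reachable F x y \<Longrightarrow> reachable F y x"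
    unfolding reachable_iff_rtrancl by (meson sym_rtrancl symD)
qed

lemma reachable_mono: "reachable F x y \<Longrightarrow> F \<subseteq> F' \<Longrightarrow> reachable F' x y"
  unfolding reachable_iff_rtrancl using rtrancl_mono[of "arcs F" "arcs F'"]
  by (auto simp: arcs_def)

lemma reachable_induct [consumes 1, case_names refl step]:
  assumes "reachable F x y" "P x"
    and "\<And>a b. reachable F x a \<Longrightarrow> {a, b} \<in> F \<Longrightarrow> P a \<Longrightarrow> P b"
  shows "P y"
proof -
  have "(x, y) \<in> (arcs F)\<^sup>*"
    using assms(1) by (simp add: reachable_iff_rtrancl)
  then show ?thesis
    by (induction rule: rtrancl_induct) (use assms in \<open>auto simp: reachable_iff_rtrancl arcs_def\<close>)
qed

text \<open>Connectedness comes with a finite certificate: two vertices joined by finitely many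
  edges are separated by only finitely many cuts with pairwise disjoint boundaries.\<close>

lemma reachable_finite_subset:
  assumes "reachable F x y"
  shows "\<exists>F'\<subseteq>F. finite F' \<and> reachable F' x y"
  using assms
proof (induction rule: reachable_induct)
  case refl
  show ?case by (intro exI[of _ "{}"]) simp
next
  case (step a b)
  then obtain F' where "F' \<subseteq> F" "finite F'" "reachable F' x a" by blast
  moreover have "reachable (insert {a, b} F') x b"
    by (meson calculation(3) insertI1 reachable_edge reachable_mono reachable_trans subset_insertI)
  ultimately show ?case
    using step by (intro exI[of _ "insert {a, b} F'"]) auto
qed

lemma reachable_crossing:
  assumes "reachable F x y" "x \<in> A" "y \<notin> A"
  shows "\<exists>e\<in>F. e \<inter> A \<noteq> {} \<and> \<not> e \<subseteq> A"
proof (rule ccontr)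
  assume no: "\<not> ?thesis"
  have "y \<in> A"
    using assms(1)
  proof (induction rule: reachable_induct)
    case (step a b)
    then show ?case using no by auto
  qed (rule assms)
  then show False using assms by blast
qed

text \<open>Injectivity of the ray excludes the crossed matching \<open>i = Suc j\<close>,
  \<open>Suc i = j\<close>. Hence a ray uses every edge at most once and finally leaves every finite
  edge set.\<close>

lemma ray_edge_eqD:
  assumes "ray V E r" "{r i, r (Suc i)} = {r j, r (Suc j)}"
  shows "i = j"
proof -
  have "(i = j \<and> Suc i = Suc j) \<or> (i = Suc j \<and> Suc i = j)"
    using assms unfolding ray_def doubleton_eq_iff by (auto dest: injD)
  then show ?thesis by auto
qed

locale conn_graph =
  fixes V :: "'v set" and E :: "'v set set"
  assumes conn: "connected_graph V E"
begin

definition finite_cut :: "'v set \<Rightarrow> bool" where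
  "finite_cut A \<longleftrightarrow> A \<subseteq> V \<and> finite (edge_boundary E A)"

text \<open>Quantifying over all rays of the end avoids the choice of a representative. The notion
  is vacuous for an empty set of rays, hence the recurring assumption
  \<open>\<omega> \<in> edge_ends V E\<close>.\<close>

definition lives :: "(nat \<Rightarrow> 'v) set \<Rightarrow> 'v set \<Rightarrow> bool" where
  "lives \<omega> A \<longleftrightarrow> (\<forall>r\<in>\<omega>. \<forall>\<^sub>F n in sequentially. r n \<in> A)"

definition end_of :: "(nat \<Rightarrow> 'v) \<Rightarrow> (nat \<Rightarrow> 'v) set" where
  "end_of r = {s. ray V E s \<and> edge_equiv E r s}"

lemma edgeE:
  assumes "e \<in> E"
  obtains x y where "e = {x, y}" "x \<noteq> y" "x \<in> V" "y \<in> V"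
  using assms conn unfolding connected_graph_def graph_def by blast

lemma reachable_V: "x \<in> V \<Longrightarrow> y \<in> V \<Longrightarrow> reachable E x y"
  using conn by (auto simp: connected_graph_def)

lemma finite_edge: "e \<in> E \<Longrightarrow> finite e"
  by (auto elim: edgeE)

section \<open>Boundaries and the Boolean algebra of finite cuts\<close>

lemma boundary_iff:
  "e \<in> edge_boundary E A \<longleftrightarrow> (\<exists>x y. e \<in> E \<and> e = {x, y} \<and> x \<in> V \<and> y \<in> V \<and> x \<in> A \<and> y \<notin> A)"
proof
  assume e: "e \<in> edge_boundary E A"
  then have "e \<in> E" by (simp add: edge_boundary_def)
  then obtain x y where "e = {x, y}" "x \<in> V" "y \<in> V" by (elim edgeE)
  then show "\<exists>x y. e \<in> E \<and> e = {x, y} \<and> x \<in> V \<and> y \<in> V \<and> x \<in> A \<and> y \<notin> A"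
    using e \<open>e \<in> E\<close> by (cases "x \<in> A") (auto simp: edge_boundary_def intro: insert_commute)
qed (auto simp: edge_boundary_def)

lemma boundaryI: "{x, y} \<in> E \<Longrightarrow> x \<in> A \<Longrightarrow> y \<notin> A \<Longrightarrow> {x, y} \<in> edge_boundary E A"
  by (auto simp: edge_boundary_def)

lemma boundary_subset: "edge_boundary E A \<subseteq> E"
  by (auto simp: edge_boundary_def)

lemma boundary_compl: "edge_boundary E (V - A) = edge_boundary E A"
proof -
  have "e \<inter> (V - A) \<noteq> {} \<and> \<not> e \<subseteq> V - A \<longleftrightarrow> e \<inter> A \<noteq> {} \<and> \<not> e \<subseteq> A" if "e \<in> E" for e
    using that by (elim edgeE) auto
  then show ?thesis by (auto simp: edge_boundary_def)
qed

lemma boundary_Un: "edge_boundary E (A \<union> B) \<subseteq> edge_boundary E A \<union> edge_boundary E B"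
  by (auto simp: edge_boundary_def)

lemma boundary_Int: "edge_boundary E (A \<inter> B) \<subseteq> edge_boundary E A \<union> edge_boundary E B"
  by (auto simp: edge_boundary_def)

lemma finite_cut_V [simp]: "finite_cut V"
proof -
  have "edge_boundary E V = {}"
    by (auto simp: boundary_iff)
  then show ?thesis by (simp add: finite_cut_def)
qed

lemma finite_cut_empty [simp]: "finite_cut {}"
  by (simp add: finite_cut_def edge_boundary_def)

lemma finite_cut_compl: "finite_cut A \<Longrightarrow> finite_cut (V - A)"
  by (simp add: finite_cut_def boundary_compl)

lemma finite_cut_Un: "finite_cut A \<Longrightarrow> finite_cut B \<Longrightarrow> finite_cut (A \<union> B)"
  unfolding finite_cut_def using boundary_Un[of A B] by (meson Un_least finite_Un finite_subset)

lemma finite_cut_Int: "finite_cut A \<Longrightarrow> finite_cut B \<Longrightarrow> finite_cut (A \<inter> B)"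
  unfolding finite_cut_def using boundary_Int[of A B] by (meson finite_Un finite_subset inf.coboundedI1)

lemma finite_cut_Diff: "finite_cut A \<Longrightarrow> finite_cut B \<Longrightarrow> finite_cut (A - B)"
proof -
  assume "finite_cut A" "finite_cut B"
  moreover from this have "A - B = A \<inter> (V - B)" by (auto simp: finite_cut_def)
  ultimately show ?thesis by (simp add: finite_cut_Int finite_cut_compl)
qed

text \<open>Each edge counted on the left lies in one of the boundaries on the right, and an edge
  counted twice on the left lies in both. Inclusion-exclusion on both sides turns this into the
  inequality.\<close>

lemma boundary_submodular:
  assumes "finite_cut A" "finite_cut B"
  shows "card (edge_boundary E (A \<union> B)) + card (edge_boundary E (A \<inter> B))
       \<le> card (edge_boundary E A) + card (edge_boundary E B)"
proof -
  let ?a = "edge_boundary E A" and ?b = "edge_boundary E B"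
  let ?u = "edge_boundary E (A \<union> B)" and ?i = "edge_boundary E (A \<inter> B)"
  have fin: "finite ?a" "finite ?b" "finite ?u" "finite ?i"
    using assms finite_cut_Un finite_cut_Int unfolding finite_cut_def by blast+
  have "card ?u + card ?i = card (?u \<union> ?i) + card (?u \<inter> ?i)"
    using fin by (intro card_Un_Int)
  also have "\<dots> \<le> card (?a \<union> ?b) + card (?a \<inter> ?b)"
  proof (intro add_mono card_mono)
    show "?u \<inter> ?i \<subseteq> ?a \<inter> ?b"
      by (auto simp: edge_boundary_def)
  qed (use fin boundary_Un boundary_Int in auto)
  also have "\<dots> = card ?a + card ?b"
    using fin by (intro card_Un_Int[symmetric])
  finally show ?thesis .
qed

text \<open>Submodularity for \<open>A\<close> and the complement of \<open>B\<close>: their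
  intersection is \<open>A - B\<close>, and their union is the complement of
  \<open>B - A\<close>.\<close>

lemma boundary_posimodular:
  assumes "finite_cut A" "finite_cut B"
  shows "card (edge_boundary E (A - B)) + card (edge_boundary E (B - A))
       \<le> card (edge_boundary E A) + card (edge_boundary E B)"
proof -
  have sub: "A \<subseteq> V" "B \<subseteq> V" using assms by (auto simp: finite_cut_def)
  have "A \<inter> (V - B) = A - B" "A \<union> (V - B) = V - (B - A)"
    using sub by auto
  then show ?thesis
    using boundary_submodular[OF assms(1) finite_cut_compl[OF assms(2)]] by (simp add: boundary_compl)
qed

lemma boundary_nonempty:
  assumes "x \<in> A" "x \<in> V" "y \<in> V" "y \<notin> A"
  shows "edge_boundary E A \<noteq> {}"
  using reachable_crossing[OF reachable_V[OF assms(2,3)] assms(1,4)] by (auto simp: edge_boundary_def)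

section \<open>Ends as ultrafilters of finite cuts\<close>

lemma ray_side:
  assumes r: "ray V E r" and A: "finite (edge_boundary E A)"
  shows "(\<forall>\<^sub>F n in sequentially. r n \<in> A) \<or> (\<forall>\<^sub>F n in sequentially. r n \<notin> A)"
proof -
  let ?e = "\<lambda>n. {r n, r (Suc n)}"
  \<comment> \<open>The edges of the ray are distinct, so only finitely many of them lie in the
    boundary; beyond the last one membership in \<open>A\<close> is constant.\<close>
  have "inj ?e"
    using ray_edge_eqD[OF r] by (auto intro!: injI)
  then have "finite (?e -` edge_boundary E A)"
    using A by (rule finite_vimageI[rotated])
  then obtain N where N: "\<And>n. n \<in> ?e -` edge_boundary E A \<Longrightarrow> n < N"
    using finite_nat_set_iff_bounded by meson
  have E: "?e n \<in> E" for n using r by (auto simp: ray_def)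
  have step: "r (Suc n) \<in> A \<longleftrightarrow> r n \<in> A" if "n \<ge> N" for n
    using N[of n] that E[of n] by (auto simp: edge_boundary_def)
  have "r n \<in> A \<longleftrightarrow> r N \<in> A" if "n \<ge> N" for n
    using that by (induction n rule: dec_induct) (auto simp: step)
  then show ?thesis
    unfolding eventually_sequentially by blast
qed

lemma edge_equiv_side:
  assumes "edge_equiv E r s" "finite (edge_boundary E A)" "\<forall>\<^sub>F n in sequentially. r n \<in> A"
  shows "\<forall>\<^sub>F n in sequentially. s n \<in> A"
proof -
  obtain m n where mn: "\<And>i j. i \<ge> m \<Longrightarrow> j \<ge> n \<Longrightarrow> reachable (E - edge_boundary E A) (r i) (s j)"
    using assms(1,2) boundary_subset unfolding edge_equiv_def by metis
  obtain k where k: "\<And>i. i \<ge> k \<Longrightarrow> r i \<in> A"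
    using assms(3) unfolding eventually_sequentially by blast
  have "s j \<in> A" if "j \<ge> n" for j
    using mn[OF max.cobounded1 that, of k] k[of "max m k"]
      reachable_crossing[of "E - edge_boundary E A" "r (max m k)" "s j" A]
    by (auto simp: edge_boundary_def)
  then show ?thesis
    unfolding eventually_sequentially by blast
qed

text \<open>From right to left, the component that contains a tail of \<open>r\<close> after
  deleting \<open>F\<close> is a finite cut, because its boundary lies in \<open>F\<close>; so it
  contains a tail of \<open>s\<close> as well. Separation by finite edge sets is thereby replaced by
  finite cuts.\<close>

lemma edge_equiv_iff:
  assumes r: "ray V E r" and s: "ray V E s"
  shows "edge_equiv E r s \<longleftrightarrow>
    (\<forall>A. finite_cut A \<longrightarrow> (\<forall>\<^sub>F n in sequentially. r n \<in> A) \<longrightarrow> (\<forall>\<^sub>F n in sequentially. s n \<in> A))"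
proof
  assume "edge_equiv E r s"
  then show "\<forall>A. finite_cut A \<longrightarrow> (\<forall>\<^sub>F n in sequentially. r n \<in> A) \<longrightarrow> (\<forall>\<^sub>F n in sequentially. s n \<in> A)"
    using edge_equiv_side unfolding finite_cut_def by blast
next
  assume *: "\<forall>A. finite_cut A \<longrightarrow> (\<forall>\<^sub>F n in sequentially. r n \<in> A) \<longrightarrow> (\<forall>\<^sub>F n in sequentially. s n \<in> A)"
  show "edge_equiv E r s"
    unfolding edge_equiv_def
  proof (intro allI impI)
    fix F assume F: "F \<subseteq> E \<and> finite F"
    let ?e = "\<lambda>n. {r n, r (Suc n)}"
    have "inj ?e"
      using ray_edge_eqD[OF r] by (auto intro!: injI)
    then have "finite (?e -` F)"
      using F by (intro finite_vimageI) auto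
    then obtain N where N: "\<And>n. n \<in> ?e -` F \<Longrightarrow> n < N"
      using finite_nat_set_iff_bounded by meson
    have rE: "?e n \<in> E" for n using r by (auto simp: ray_def)
    have tail: "reachable (E - F) (r N) (r n)" if "n \<ge> N" for n
      using that
    proof (induction n rule: dec_induct)
      case (step n)
      have "?e n \<in> E - F" using N[of n] step rE[of n] by auto
      then show ?case using step reachable_edge reachable_trans by metis
    qed simp
    define A where "A = {v \<in> V. reachable (E - F) (r N) v}"
    have "edge_boundary E A \<subseteq> F"
    proof
      fix e assume "e \<in> edge_boundary E A"
      then obtain x y where e: "e \<in> E" "e = {x, y}" "y \<in> V" "x \<in> A" "y \<notin> A"
        by (auto simp: boundary_iff)
      then show "e \<in> F"
        unfolding A_def by (metis (mono_tags, lifting) DiffI mem_Collect_eq reachable_edge reachable_trans)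
    qed
    then have "finite_cut A"
      using F unfolding finite_cut_def by (auto simp: A_def intro: finite_subset)
    moreover have "\<forall>\<^sub>F n in sequentially. r n \<in> A"
      unfolding eventually_sequentially A_def using tail r by (auto simp: ray_def)
    ultimately have "\<forall>\<^sub>F n in sequentially. s n \<in> A"
      using * by blast
    then obtain M where M: "\<And>j. j \<ge> M \<Longrightarrow> s j \<in> A"
      unfolding eventually_sequentially by blast
    have "reachable (E - F) (r i) (s j)" if "i \<ge> N" "j \<ge> M" for i j
      using tail[OF that(1)] M[OF that(2)] reachable_sym reachable_trans unfolding A_def by fast
    then show "\<exists>m n. \<forall>i\<ge>m. \<forall>j\<ge>n. reachable (E - F) (r i) (s j)"
      by blast
  qed
qed

lemma edge_ends_eq: "edge_ends V E = end_of ` {r. ray V E r}"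
  by (auto simp: edge_ends_def end_of_def)

lemma ray_in_end_of: "ray V E r \<Longrightarrow> r \<in> end_of r"
  by (simp add: end_of_def edge_equiv_iff)

lemma lives_end_of:
  assumes "ray V E r" "finite_cut A"
  shows "lives (end_of r) A \<longleftrightarrow> (\<forall>\<^sub>F n in sequentially. r n \<in> A)"
proof
  show "lives (end_of r) A \<Longrightarrow> \<forall>\<^sub>F n in sequentially. r n \<in> A"
    using ray_in_end_of[OF assms(1)] by (simp add: lives_def)
  show "\<forall>\<^sub>F n in sequentially. r n \<in> A \<Longrightarrow> lives (end_of r) A"
    using assms by (auto simp: lives_def end_of_def edge_equiv_iff)
qed

lemma endE:
  assumes "\<omega> \<in> edge_ends V E"
  obtains r where "ray V E r" "\<omega> = end_of r" "r \<in> \<omega>"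
  using assms ray_in_end_of unfolding edge_ends_eq by blast

lemma lives_mono: "lives \<omega> A \<Longrightarrow> A \<subseteq> B \<Longrightarrow> lives \<omega> B"
  unfolding lives_def by (meson eventually_mono subsetD)

lemma lives_Int: "lives \<omega> (A \<inter> B) \<longleftrightarrow> lives \<omega> A \<and> lives \<omega> B"
  by (auto simp: lives_def eventually_conj_iff)

lemma lives_V: "\<omega> \<in> edge_ends V E \<Longrightarrow> lives \<omega> V"
  by (auto simp: lives_def edge_ends_def ray_def)

lemma lives_nonempty: "\<omega> \<in> edge_ends V E \<Longrightarrow> lives \<omega> A \<Longrightarrow> A \<noteq> {}"
  by (auto simp: lives_def elim!: endE)

text \<open>A ray crosses a finite boundary finitely often, so each end decides for exactly one
  side. Together with \<open>lives_Int\<close> and \<open>lives_mono\<close> this makes the cuts in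
  which an end lives an ultrafilter.\<close>

lemma lives_compl:
  assumes "\<omega> \<in> edge_ends V E" "finite_cut A"
  shows "lives \<omega> (V - A) \<longleftrightarrow> \<not> lives \<omega> A"
proof
  assume "lives \<omega> (V - A)"
  then show "\<not> lives \<omega> A"
    using lives_nonempty[OF assms(1), of "(V - A) \<inter> A"] lives_Int by (metis Diff_disjoint inf_commute)
next
  obtain r where r: "ray V E r" "\<omega> = end_of r" using assms by (elim endE)
  assume "\<not> lives \<omega> A"
  then have "\<forall>\<^sub>F n in sequentially. r n \<notin> A"
    using ray_side[OF r(1), of A] assms lives_end_of r by (auto simp: finite_cut_def)
  then have "\<forall>\<^sub>F n in sequentially. r n \<in> V - A"
    using r by (auto simp: ray_def)
  then show "lives \<omega> (V - A)"
    using r assms by (simp add: lives_end_of finite_cut_compl)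
qed

lemma lives_Diff:
  assumes "\<omega> \<in> edge_ends V E" "finite_cut A" "finite_cut B"
  shows "lives \<omega> (A - B) \<longleftrightarrow> lives \<omega> A \<and> \<not> lives \<omega> B"
proof -
  have "A - B = A \<inter> (V - B)" using assms by (auto simp: finite_cut_def)
  then show ?thesis using assms by (simp add: lives_Int lives_compl)
qed

lemma lives_disjoint:
  assumes "\<omega> \<in> edge_ends V E" "lives \<omega> A" "lives \<omega> B"
  shows "A \<inter> B \<noteq> {}"
  using assms lives_Int lives_nonempty by blast

text \<open>If every cut around one end also surrounded the other, complements would give the
  converse, and the two ends would have equivalent rays.\<close>

lemma ends_separated:
  assumes "\<omega> \<in> edge_ends V E" "\<eta> \<in> edge_ends V E" "\<omega> \<noteq> \<eta>"
  shows "\<exists>A. finite_cut A \<and> lives \<omega> A \<and> \<not> lives \<eta> A"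
proof (rule ccontr)
  assume no: "\<not> ?thesis"
  obtain r s where r: "ray V E r" "\<omega> = end_of r" and s: "ray V E s" "\<eta> = end_of s"
    using assms by (elim endE)
  have "lives \<omega> A \<longleftrightarrow> lives \<eta> A" if "finite_cut A" for A
    using no that lives_compl[OF assms(1) that] lives_compl[OF assms(2) that] finite_cut_compl by blast
  then have "(\<forall>\<^sub>F n in sequentially. r n \<in> A) \<longleftrightarrow> (\<forall>\<^sub>F n in sequentially. s n \<in> A)" if "finite_cut A" for A
    using that r s by (simp add: lives_end_of)
  then have "end_of r = end_of s"
    using r s by (auto simp: end_of_def edge_equiv_iff)
  then show False using r s assms by simp
qed

section \<open>Regions, components and the topology\<close>

lemma region_imp_finite_cut: "region V E C \<Longrightarrow> finite_cut C"
  by (simp add: region_def finite_cut_def)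

definition graph_components :: "'v set \<Rightarrow> 'v set set" where
  "graph_components A = (\<lambda>v. {u. reachable {e \<in> E. e \<subseteq> A} v u}) ` A"

lemma component_subset: "C \<in> graph_components A \<Longrightarrow> C \<subseteq> A"
proof
  fix u assume "C \<in> graph_components A" "u \<in> C"
  then obtain v where "v \<in> A" "reachable {e \<in> E. e \<subseteq> A} v u"
    by (auto simp: graph_components_def)
  then show "u \<in> A"
    using reachable_crossing[of "{e \<in> E. e \<subseteq> A}" v u A] by auto
qed

lemma disjoint_components:
  assumes "C \<in> graph_components A" "C' \<in> graph_components A" "C \<inter> C' \<noteq> {}"
  shows "C = C'"
  using assms unfolding graph_components_def by (auto; meson reachable_sym reachable_trans)

text \<open>An edge leaving a component inside \<open>A\<close> would enlarge the component, so its
  boundary edges are boundary edges of \<open>A\<close>. Connectedness has to be proved again with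
  respect to the edges inside the component itself.\<close>

lemma component_region:
  assumes "finite_cut A" "C \<in> graph_components A"
  shows "region V E C"
proof -
  obtain v where v: "v \<in> A" and C: "C = {u. reachable {e \<in> E. e \<subseteq> A} v u}"
    using assms by (auto simp: graph_components_def)
  have sub: "C \<subseteq> A" using assms component_subset by blast
  have "reachable {e \<in> E. e \<subseteq> C} v u" if "reachable {e \<in> E. e \<subseteq> A} v u" for u
    using that
  proof (induction rule: reachable_induct)
    case (step a b)
    have "reachable {e \<in> E. e \<subseteq> A} v b"
      using step.hyps by (rule reachable_step)
    then have "{a, b} \<in> {e \<in> E. e \<subseteq> C}"
      using step.hyps by (simp add: C)
    then show ?case using step.IH by (rule reachable_step[rotated])
  qed simp
  then have from_v: "reachable {e \<in> E. e \<subseteq> C} v u" if "u \<in> C" for u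
    using that by (simp add: C)
  have "\<forall>x\<in>C. \<forall>y\<in>C. reachable {e \<in> E. e \<subseteq> C} x y"
    by (intro ballI reachable_trans[OF reachable_sym[OF from_v] from_v])
  moreover have "edge_boundary E C \<subseteq> edge_boundary E A"
  proof
    fix e assume "e \<in> edge_boundary E C"
    then obtain x y where e: "e \<in> E" "e = {x, y}" "x \<in> C" "y \<notin> C"
      by (auto simp: boundary_iff)
    have "y \<notin> A"
    proof
      assume "y \<in> A"
      then have "reachable {e \<in> E. e \<subseteq> A} x y"
        using e sub by (intro reachable_edge) auto
      then show False
        using e reachable_trans[of _ v x y] by (auto simp: C)
    qed
    then show "e \<in> edge_boundary E A"
      using e sub by (auto simp: edge_boundary_def)
  qed
  moreover have "v \<in> C" unfolding C by simp
  ultimately show ?thesis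
    using assms sub unfolding region_def finite_cut_def by (auto intro: finite_subset)
qed

text \<open>A tail of a ray contained in \<open>A\<close> is connected within \<open>A\<close>, so
  it stays in one component.\<close>

lemma lives_component:
  assumes "\<omega> \<in> edge_ends V E" "finite_cut A" "lives \<omega> A"
  shows "\<exists>C\<in>graph_components A. lives \<omega> C"
proof -
  obtain r where r: "ray V E r" "\<omega> = end_of r" "r \<in> \<omega>" using assms by (elim endE)
  obtain N where N: "\<And>n. n \<ge> N \<Longrightarrow> r n \<in> A"
    using assms r unfolding lives_def eventually_sequentially by blast
  define C where "C = {u. reachable {e \<in> E. e \<subseteq> A} (r N) u}"
  have "r n \<in> C" if "n \<ge> N" for n
    using that
  proof (induction n rule: dec_induct)
    case (step n)
    have "{r n, r (Suc n)} \<in> {e \<in> E. e \<subseteq> A}"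
      using r N step by (auto simp: ray_def)
    then show ?case using step reachable_step unfolding C_def by fast
  qed (simp add: C_def)
  then have ev: "\<forall>\<^sub>F n in sequentially. r n \<in> C"
    unfolding eventually_sequentially by blast
  have "C \<in> graph_components A"
    using N[of N] by (auto simp: graph_components_def C_def)
  moreover from this have "lives \<omega> C"
    using lives_end_of[OF r(1) region_imp_finite_cut[OF component_region[OF assms(2)]]] ev r by blast
  ultimately show ?thesis by blast
qed

lemma ray_shift: "ray V E r \<Longrightarrow> ray V E (\<lambda>n. r (n + k))"
  unfolding ray_def inj_def by (metis add_Suc add_right_cancel)

lemma end_of_eqI:
  assumes "ray V E r" "ray V E s" "\<And>n. r (n + k) = s (n + l)"
  shows "end_of r = end_of s"
proof -
  have "(\<forall>\<^sub>F n in sequentially. r n \<in> A) \<longleftrightarrow> (\<forall>\<^sub>F n in sequentially. s n \<in> A)" for A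
    using assms(3) eventually_sequentially_seg[of "\<lambda>n. r n \<in> A" k]
      eventually_sequentially_seg[of "\<lambda>n. s n \<in> A" l] by simp
  then show ?thesis
    using assms by (auto simp: end_of_def edge_equiv_iff)
qed

text \<open>A ray inside \<open>C\<close> rules out that the end lives in \<open>V - C\<close>, and
  the dichotomy for finite cuts does the rest. Conversely, a tail of a ray of the end is again a ray
  of it.\<close>

lemma ends_in_eq:
  assumes "region V E C"
  shows "ends_in V E C = {\<omega> \<in> edge_ends V E. lives \<omega> C}"
proof (intro equalityI subsetI)
  fix \<omega> assume "\<omega> \<in> ends_in V E C"
  then obtain r where \<omega>: "\<omega> \<in> edge_ends V E" and r: "r \<in> \<omega>" "\<And>n. r n \<in> C"
    by (auto simp: ends_in_def)
  have "\<not> (\<forall>\<^sub>F n in sequentially. r n \<in> V - C)"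
    using r by simp
  then have "\<not> lives \<omega> (V - C)"
    using r(1) unfolding lives_def by blast
  then show "\<omega> \<in> {\<omega> \<in> edge_ends V E. lives \<omega> C}"
    using \<omega> lives_compl region_imp_finite_cut[OF assms] by blast
next
  fix \<omega> assume "\<omega> \<in> {\<omega> \<in> edge_ends V E. lives \<omega> C}"
  then have \<omega>: "\<omega> \<in> edge_ends V E" "lives \<omega> C" by auto
  obtain r where r: "ray V E r" "\<omega> = end_of r" "r \<in> \<omega>" using \<omega> by (elim endE)
  obtain N where N: "\<And>n. n \<ge> N \<Longrightarrow> r n \<in> C"
    using \<omega> r unfolding lives_def eventually_sequentially by blast
  let ?s = "\<lambda>n. r (n + N)"
  have s: "ray V E ?s" using r ray_shift by blast
  have "end_of ?s = \<omega>"
    using end_of_eqI[OF s r(1), of 0 N] r by simp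
  then have "?s \<in> \<omega>" using ray_in_end_of[OF s] by simp
  moreover have "\<forall>n. ?s n \<in> C" using N by simp
  ultimately show "\<omega> \<in> ends_in V E C"
    using \<omega> by (auto simp: ends_in_def)
qed

text \<open>Finite cuts generate the same topology as regions, since an end living in a cut lives in
  one of its components. Closure of cuts under intersection then yields the axioms of a topology
  directly.\<close>

lemma openin_edge_end_space:
  "openin (edge_end_space V E) U \<longleftrightarrow> U \<subseteq> edge_ends V E \<and>
     (\<forall>\<omega>\<in>U. \<exists>A. finite_cut A \<and> lives \<omega> A \<and> (\<forall>\<eta>\<in>edge_ends V E. lives \<eta> A \<longrightarrow> \<eta> \<in> U))"
proof -
  define P where "P U \<longleftrightarrow> U \<subseteq> edge_ends V E \<and>
     (\<forall>\<omega>\<in>U. \<exists>A. finite_cut A \<and> lives \<omega> A \<and> (\<forall>\<eta>\<in>edge_ends V E. lives \<eta> A \<longrightarrow> \<eta> \<in> U))" for U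
  have "(U \<subseteq> edge_ends V E \<and>
      (\<forall>\<omega>\<in>U. \<exists>C. region V E C \<and> \<omega> \<in> ends_in V E C \<and> ends_in V E C \<subseteq> U)) = P U" for U
  proof (cases "U \<subseteq> edge_ends V E")
    case True
    have "(\<exists>C. region V E C \<and> \<omega> \<in> ends_in V E C \<and> ends_in V E C \<subseteq> U) \<longleftrightarrow>
          (\<exists>A. finite_cut A \<and> lives \<omega> A \<and> (\<forall>\<eta>\<in>edge_ends V E. lives \<eta> A \<longrightarrow> \<eta> \<in> U))" if "\<omega> \<in> U" for \<omega>
    proof
      assume "\<exists>C. region V E C \<and> \<omega> \<in> ends_in V E C \<and> ends_in V E C \<subseteq> U"
      then obtain C where "region V E C" "\<omega> \<in> ends_in V E C" "ends_in V E C \<subseteq> U" by blast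
      then show "\<exists>A. finite_cut A \<and> lives \<omega> A \<and> (\<forall>\<eta>\<in>edge_ends V E. lives \<eta> A \<longrightarrow> \<eta> \<in> U)"
        using region_imp_finite_cut[of C] ends_in_eq[of C] by blast
    next
      assume "\<exists>A. finite_cut A \<and> lives \<omega> A \<and> (\<forall>\<eta>\<in>edge_ends V E. lives \<eta> A \<longrightarrow> \<eta> \<in> U)"
      then obtain A where A: "finite_cut A" "lives \<omega> A" "\<forall>\<eta>\<in>edge_ends V E. lives \<eta> A \<longrightarrow> \<eta> \<in> U" by blast
      have "\<omega> \<in> edge_ends V E" using True that by blast
      then obtain C where C: "C \<in> graph_components A" "lives \<omega> C" using A lives_component by blast
      have reg: "region V E C" using A C component_region by blast
      then show "\<exists>C. region V E C \<and> \<omega> \<in> ends_in V E C \<and> ends_in V E C \<subseteq> U"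
        using ends_in_eq[OF reg] A C component_subset[OF C(1)] lives_mono \<open>\<omega> \<in> edge_ends V E\<close>
        by (intro exI[of _ C]) auto
    qed
    then show ?thesis using True by (simp add: P_def)
  qed (simp add: P_def)
  then have eq: "edge_end_space V E = topology P"
    unfolding edge_end_space_def by simp
  have "istopology P"
    unfolding istopology_def
  proof (intro conjI allI impI)
    fix S T assume S: "P S" and T: "P T"
    show "P (S \<inter> T)"
      unfolding P_def
    proof (intro conjI ballI)
      fix \<omega> assume \<omega>: "\<omega> \<in> S \<inter> T"
      obtain A where A: "finite_cut A" "lives \<omega> A" "\<forall>\<eta>\<in>edge_ends V E. lives \<eta> A \<longrightarrow> \<eta> \<in> S"
        using S \<omega> unfolding P_def by blast
      obtain B where B: "finite_cut B" "lives \<omega> B" "\<forall>\<eta>\<in>edge_ends V E. lives \<eta> B \<longrightarrow> \<eta> \<in> T"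
        using T \<omega> unfolding P_def by blast
      show "\<exists>A. finite_cut A \<and> lives \<omega> A \<and> (\<forall>\<eta>\<in>edge_ends V E. lives \<eta> A \<longrightarrow> \<eta> \<in> S \<inter> T)"
        using A B by (intro exI[of _ "A \<inter> B"]) (auto simp: finite_cut_Int lives_Int)
    qed (use S in \<open>auto simp: P_def\<close>)
  next
    fix \<K> assume K: "\<forall>K\<in>\<K>. P K"
    show "P (\<Union>\<K>)"
      unfolding P_def
    proof (intro conjI ballI)
      fix \<omega> assume "\<omega> \<in> \<Union>\<K>"
      then obtain K where K': "K \<in> \<K>" "\<omega> \<in> K" by blast
      then have "P K" using K by blast
      then obtain A where "finite_cut A" "lives \<omega> A" "\<forall>\<eta>\<in>edge_ends V E. lives \<eta> A \<longrightarrow> \<eta> \<in> K"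
        using K'(2) unfolding P_def by blast
      then show "\<exists>A. finite_cut A \<and> lives \<omega> A \<and> (\<forall>\<eta>\<in>edge_ends V E. lives \<eta> A \<longrightarrow> \<eta> \<in> \<Union>\<K>)"
        using K'(1) by (intro exI[of _ A]) auto
    qed (use K in \<open>auto simp: P_def\<close>)
  qed
  then show ?thesis
    by (simp add: eq topology_inverse' P_def)
qed

lemma topspace_edge_end_space [simp]: "topspace (edge_end_space V E) = edge_ends V E"
proof (rule antisym)
  show "topspace (edge_end_space V E) \<subseteq> edge_ends V E"
    using openin_edge_end_space[of "topspace (edge_end_space V E)"] by simp
  have "openin (edge_end_space V E) (edge_ends V E)"
    unfolding openin_edge_end_space using finite_cut_V lives_V by blast
  then show "edge_ends V E \<subseteq> topspace (edge_end_space V E)"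
    by (rule openin_subset)
qed

lemma openin_lives: "finite_cut A \<Longrightarrow> openin (edge_end_space V E) {\<omega> \<in> edge_ends V E. lives \<omega> A}"
  unfolding openin_edge_end_space by blast

text \<open>Eventually \<open>D i\<close> misses the finitely many endpoints of the boundary edges
  of \<open>A\<close>. A connected set doing so lies on one side of \<open>A\<close>, and it meets
  \<open>A\<close> because the end lives in both.\<close>

lemma shrinking_regions:
  assumes reg: "\<And>i::nat. region V E (D i)"
    and van: "\<And>v. v \<in> V \<Longrightarrow> \<forall>\<^sub>F i in sequentially. v \<notin> D i"
    and \<omega>: "\<omega> \<in> edge_ends V E" "\<And>i. lives \<omega> (D i)"
    and A: "finite_cut A" "lives \<omega> A"
  shows "\<forall>\<^sub>F i in sequentially. D i \<subseteq> A"
proof -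
  have "finite (\<Union> (edge_boundary E A))" "\<Union> (edge_boundary E A) \<subseteq> V"
    using A finite_edge boundary_subset by (auto simp: finite_cut_def boundary_iff)
  then have "\<forall>\<^sub>F i in sequentially. \<forall>v\<in>\<Union> (edge_boundary E A). v \<notin> D i"
    using van by (intro eventually_ball_finite) blast+
  then show ?thesis
  proof (rule eventually_mono)
    fix i assume i: "\<forall>v\<in>\<Union> (edge_boundary E A). v \<notin> D i"
    obtain x where x: "x \<in> D i" "x \<in> A"
      using lives_disjoint[OF \<omega>(1) \<omega>(2) A(2)] by blast
    show "D i \<subseteq> A"
    proof
      fix y assume y: "y \<in> D i"
      show "y \<in> A"
      proof (rule ccontr)
        assume "y \<notin> A"
        moreover have "reachable {e \<in> E. e \<subseteq> D i} x y"
          using reg x y by (auto simp: region_def)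
        ultimately obtain e where "e \<in> E" "e \<subseteq> D i" "e \<inter> A \<noteq> {}" "\<not> e \<subseteq> A"
          using reachable_crossing[of _ x y A] x by blast
        then show False using i by (auto simp: edge_boundary_def)
      qed
    qed
  qed
qed

end

section \<open>Disjoint cuts avoiding a vertex set\<close>

context conn_graph
begin

text \<open>Minimality refers to a single end. This witness may differ from the end that is to be
  captured, and it provides the competing cuts in every uncrossing argument.\<close>

definition tight :: "'v set \<Rightarrow> 'v set \<Rightarrow> bool" where
  "tight Y S \<longleftrightarrow> finite_cut S \<and> S \<inter> Y = {} \<and>
     (\<exists>\<eta>\<in>edge_ends V E. lives \<eta> S \<and>
        (\<forall>A. finite_cut A \<and> A \<inter> Y = {} \<and> lives \<eta> A \<longrightarrow>
           card (edge_boundary E S) \<le> card (edge_boundary E A)))"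

lemma exists_tight:
  assumes "\<omega> \<in> edge_ends V E" "finite_cut A" "A \<inter> Y = {}" "lives \<omega> A"
  obtains S where "finite_cut S" "S \<inter> Y = {}" "lives \<omega> S"
    "card (edge_boundary E S) \<le> card (edge_boundary E A)"
    "\<And>B. finite_cut B \<Longrightarrow> B \<inter> Y = {} \<Longrightarrow> lives \<omega> B \<Longrightarrow>
       card (edge_boundary E S) \<le> card (edge_boundary E B)"
proof -
  let ?P = "\<lambda>A. finite_cut A \<and> A \<inter> Y = {} \<and> lives \<omega> A"
  have "\<exists>S. ?P S \<and> (\<forall>B. ?P B \<longrightarrow> card (edge_boundary E S) \<le> card (edge_boundary E B))"
    using assms by (intro ex_has_least_nat) auto
  then show ?thesis
    using that assms by blast
qed

text \<open>If the witness end of \<open>S\<close> lives in \<open>A\<close>, then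
  \<open>A \<inter> S\<close> competes with \<open>S\<close> and submodularity bounds
  \<open>A \<union> S\<close>; otherwise \<open>S - A\<close> competes and posimodularity bounds
  \<open>A - S\<close>. Removing \<open>S\<close> does not lose \<open>\<omega>\<close>, which does
  not live there.\<close>

lemma tight_uncross:
  assumes S: "tight Y S" and A: "finite_cut A" "A \<inter> Y = {}"
    and \<omega>: "\<omega> \<in> edge_ends V E" "lives \<omega> A" "\<not> lives \<omega> S"
  shows "\<exists>A'. (A' = A \<union> S \<or> A' = A - S) \<and> finite_cut A' \<and> A' \<inter> Y = {} \<and> lives \<omega> A' \<and>
           card (edge_boundary E A') \<le> card (edge_boundary E A)"
proof -
  obtain \<eta> where \<eta>: "finite_cut S" "S \<inter> Y = {}" "\<eta> \<in> edge_ends V E" "lives \<eta> S"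
    and min: "\<And>B. finite_cut B \<Longrightarrow> B \<inter> Y = {} \<Longrightarrow> lives \<eta> B \<Longrightarrow>
       card (edge_boundary E S) \<le> card (edge_boundary E B)"
    using S unfolding tight_def by blast
  show ?thesis
  proof (cases "lives \<eta> A")
    case True
    then have "card (edge_boundary E S) \<le> card (edge_boundary E (A \<inter> S))"
      using \<eta> A by (intro min) (auto simp: finite_cut_Int lives_Int)
    then have "card (edge_boundary E (A \<union> S)) \<le> card (edge_boundary E A)"
      using boundary_submodular[OF A(1) \<eta>(1)] by linarith
    moreover have "lives \<omega> (A \<union> S)"
      using \<omega> lives_mono by blast
    ultimately show ?thesis
      using A \<eta> by (intro exI[of _ "A \<union> S"]) (auto simp: finite_cut_Un)
  next
    case False
    then have "card (edge_boundary E S) \<le> card (edge_boundary E (S - A))"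
      using \<eta> A by (intro min) (auto simp: finite_cut_Diff lives_Diff)
    then have "card (edge_boundary E (A - S)) \<le> card (edge_boundary E A)"
      using boundary_posimodular[OF A(1) \<eta>(1)] by linarith
    then show ?thesis
      using A \<eta> \<omega> by (intro exI[of _ "A - S"]) (auto simp: finite_cut_Diff lives_Diff)
  qed
qed

text \<open>Without such an edge the boundary of \<open>S \<inter> A\<close> is contained in that of
  \<open>S\<close>, hence equal to it by \<open>le\<close>. But the graph is connected, so some edge
  leaves \<open>S - A\<close>; it can only leave \<open>S\<close> and has no endpoint in
  \<open>S \<inter> A\<close>, a contradiction.\<close>

lemma tight_crossing_edge_aux:
  assumes S: "finite_cut S" and A: "finite_cut A" and cross: "S \<inter> A \<noteq> {}" "S - A \<noteq> {}"
    and le: "card (edge_boundary E S) \<le> card (edge_boundary E (S \<inter> A))"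
  shows "\<exists>e\<in>edge_boundary E A. e \<subseteq> S"
proof (rule ccontr)
  assume no: "\<not> ?thesis"
  have "edge_boundary E (S \<inter> A) \<subseteq> edge_boundary E S"
    using no by (auto simp: edge_boundary_def)
  then have eq: "edge_boundary E (S \<inter> A) = edge_boundary E S"
    using S le by (intro card_seteq) (auto simp: finite_cut_def)
  obtain x y where "x \<in> S - A" "y \<in> S \<inter> A" using cross by blast
  then have "edge_boundary E (S - A) \<noteq> {}"
    using S by (intro boundary_nonempty[of x _ y]) (auto simp: finite_cut_def)
  then obtain a b where ab: "{a, b} \<in> E" "a \<in> S - A" "b \<notin> S - A"
    unfolding ex_in_conv[symmetric] boundary_iff by blast
  have "b \<notin> S"
  proof
    assume "b \<in> S"
    then have "{b, a} \<in> edge_boundary E A" "{b, a} \<subseteq> S"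
      using ab boundaryI[of b a A] by (auto simp: insert_commute)
    then show False using no by blast
  qed
  then have "{a, b} \<in> edge_boundary E S" "{a, b} \<inter> (S \<inter> A) = {}"
    using ab by (auto intro: boundaryI)
  then show False
    unfolding eq[symmetric] by (auto simp: edge_boundary_def)
qed

text \<open>The witness end lives in one of the two parts into which \<open>A\<close> divides
  \<open>S\<close>, and that part competes with \<open>S\<close>. Both cases reduce to the same
  argument because \<open>A\<close> and its complement have the same boundary.\<close>

lemma tight_crossing_edge:
  assumes S: "tight Y S" and A: "finite_cut A" and cross: "S \<inter> A \<noteq> {}" "S - A \<noteq> {}"
  shows "\<exists>e\<in>edge_boundary E A. e \<subseteq> S"
proof -
  obtain \<eta> where \<eta>: "finite_cut S" "S \<inter> Y = {}" "\<eta> \<in> edge_ends V E" "lives \<eta> S"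
    and min: "\<And>B. finite_cut B \<Longrightarrow> B \<inter> Y = {} \<Longrightarrow> lives \<eta> B \<Longrightarrow>
       card (edge_boundary E S) \<le> card (edge_boundary E B)"
    using S unfolding tight_def by blast
  show ?thesis
  proof (cases "lives \<eta> A")
    case True
    then show ?thesis
      using \<eta> A cross by (intro tight_crossing_edge_aux min) (auto simp: finite_cut_Int lives_Int)
  next
    case False
    have "S \<subseteq> V" using \<eta> by (simp add: finite_cut_def)
    then have "S \<inter> (V - A) = S - A" "S - (V - A) = S \<inter> A" by auto
    moreover have "card (edge_boundary E S) \<le> card (edge_boundary E (S - A))"
      using \<eta> A False by (intro min) (auto simp: finite_cut_Diff lives_Diff)
    ultimately show ?thesis
      using tight_crossing_edge_aux[OF \<eta>(1) finite_cut_compl[OF A]] cross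
      by (simp add: boundary_compl)
  qed
qed

text \<open>Each crossing member contains a boundary edge of \<open>A\<close>, and disjoint members
  contain different ones.\<close>

lemma finite_crossing:
  assumes A: "finite_cut A" and \<S>: "disjoint \<S>" "\<And>S. S \<in> \<S> \<Longrightarrow> tight Y S"
  shows "finite {S \<in> \<S>. S \<inter> A \<noteq> {} \<and> S - A \<noteq> {}}"
proof -
  let ?X = "{S \<in> \<S>. S \<inter> A \<noteq> {} \<and> S - A \<noteq> {}}"
  have "\<forall>S\<in>?X. \<exists>e. e \<in> edge_boundary E A \<and> e \<subseteq> S"
    using tight_crossing_edge[OF \<S>(2) A] by blast
  from bchoice[OF this] obtain f
    where f: "\<And>S. S \<in> ?X \<Longrightarrow> f S \<in> edge_boundary E A \<and> f S \<subseteq> S"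
    by blast
  have "inj_on f ?X"
  proof
    fix S T assume S: "S \<in> ?X" and T: "T \<in> ?X" and eq: "f S = f T"
    have "f S \<noteq> {}" using f[OF S] by (auto simp: edge_boundary_def)
    then have "S \<inter> T \<noteq> {}" using f[OF S] f[OF T] eq by blast
    then show "S = T" using S T \<S>(1) by (auto simp: disjoint_def)
  qed
  moreover have "f ` ?X \<subseteq> edge_boundary E A" using f by blast
  ultimately show ?thesis
    using A by (auto simp: finite_cut_def intro: inj_on_finite)
qed

text \<open>The members are absorbed or removed one at a time; being disjoint, they do not disturb
  each other. The equation off \<open>\<Union>\<S>\<close> records that the position relative to
  sets disjoint from all members is unchanged.\<close>

lemma tight_uncross_finite:
  assumes "finite \<S>" "disjoint \<S>" "\<And>S. S \<in> \<S> \<Longrightarrow> tight Y S \<and> \<not> lives \<omega> S"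
    and A: "finite_cut A" "A \<inter> Y = {}" and \<omega>: "\<omega> \<in> edge_ends V E" "lives \<omega> A"
  shows "\<exists>A'. finite_cut A' \<and> A' \<inter> Y = {} \<and> lives \<omega> A' \<and>
           card (edge_boundary E A') \<le> card (edge_boundary E A) \<and>
           A' - \<Union>\<S> = A - \<Union>\<S> \<and> (\<forall>S\<in>\<S>. S \<subseteq> A' \<or> S \<inter> A' = {})"
  using assms(1-3)
proof (induction \<S> rule: finite_induct)
  case empty
  then show ?case using A \<omega> by blast
next
  case (insert S \<S>)
  have dj: "disjoint \<S>" using insert.prems by (simp add: pairwise_insert)
  have tn: "tight Y T \<and> \<not> lives \<omega> T" if "T \<in> \<S>" for T
    using insert.prems that by blast
  have "\<exists>A'. finite_cut A' \<and> A' \<inter> Y = {} \<and> lives \<omega> A' \<and>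
      card (edge_boundary E A') \<le> card (edge_boundary E A) \<and>
      A' - \<Union>\<S> = A - \<Union>\<S> \<and> (\<forall>S\<in>\<S>. S \<subseteq> A' \<or> S \<inter> A' = {})"
    by (rule insert.IH[OF dj]) (rule tn)
  then obtain A' where A': "finite_cut A'" "A' \<inter> Y = {}" "lives \<omega> A'"
      "card (edge_boundary E A') \<le> card (edge_boundary E A)"
      "A' - \<Union>\<S> = A - \<Union>\<S>" "\<forall>S\<in>\<S>. S \<subseteq> A' \<or> S \<inter> A' = {}"
    by (elim exE conjE) (rule that)
  have tS: "tight Y S" and nS: "\<not> lives \<omega> S" using insert.prems by auto
  obtain B where B: "B = A' \<union> S \<or> B = A' - S" "finite_cut B" "B \<inter> Y = {}" "lives \<omega> B"
      "card (edge_boundary E B) \<le> card (edge_boundary E A')"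
    using tight_uncross[OF tS A'(1,2) \<omega>(1) A'(3) nS] by (elim exE conjE) (rule that)
  have disj: "T \<inter> S = {}" if "T \<in> \<S>" for T
    using insert that by (auto simp: disjoint_def)
  have "T \<subseteq> B \<or> T \<inter> B = {}" if "T \<in> insert S \<S>" for T
    using that A'(6) B(1) disj by blast
  moreover have "B - \<Union>(insert S \<S>) = A - \<Union>(insert S \<S>)"
    using B(1) A'(5) by blast
  ultimately show ?case
    using B A' by (intro exI[of _ B]) auto
qed

text \<open>Finitely many boundary edges of the union have their inner endpoints in a single member
  of the chain and are boundary edges of that member. So there are at most \<open>k\<close> of them,
  and the witness end of a member carrying the whole boundary serves for the union.\<close>

lemma tight_Union_chain:
  assumes ch: "\<And>S T. S \<in> \<S> \<Longrightarrow> T \<in> \<S> \<Longrightarrow> S \<subseteq> T \<or> T \<subseteq> S" and ne: "\<S> \<noteq> {}"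
    and t: "\<And>S. S \<in> \<S> \<Longrightarrow> tight Y S \<and> card (edge_boundary E S) \<le> k"
  shows "tight Y (\<Union>\<S>) \<and> card (edge_boundary E (\<Union>\<S>)) \<le> k"
proof -
  let ?b = "edge_boundary E (\<Union>\<S>)"
  have sub: "\<exists>S\<in>\<S>. F \<subseteq> edge_boundary E S" if "finite F" "F \<subseteq> ?b" for F
  proof -
    have "\<forall>e\<in>F. \<exists>S. S \<in> \<S> \<and> e \<inter> S \<noteq> {}"
      using that unfolding edge_boundary_def by blast
    then obtain f where f: "\<And>e. e \<in> F \<Longrightarrow> f e \<in> \<S> \<and> e \<inter> f e \<noteq> {}"
      by metis
    have "\<exists>S\<in>\<S>. \<forall>e\<in>F. f e \<subseteq> S"
      using that(1) f
    proof (induction F rule: finite_induct)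
      case empty
      then show ?case using ne by blast
    next
      case (insert e F)
      then obtain S where S: "S \<in> \<S>" "\<forall>e\<in>F. f e \<subseteq> S" by blast
      have fe: "f e \<in> \<S>" using insert by blast
      then consider "f e \<subseteq> S" | "S \<subseteq> f e" using ch[of S "f e"] S by blast
      then show ?case
      proof cases
        case 1
        then show ?thesis using S by (intro bexI[of _ S]) auto
      next
        case 2
        then show ?thesis using S fe by (intro bexI[of _ "f e"]) auto
      qed
    qed
    then obtain S where S: "S \<in> \<S>" "\<forall>e\<in>F. f e \<subseteq> S" by blast
    have "F \<subseteq> edge_boundary E S"
    proof
      fix e assume e: "e \<in> F"
      have "e \<inter> S \<noteq> {}" using f[OF e] S e by blast
      moreover have "e \<in> E" "\<not> e \<subseteq> \<Union>\<S>"
        using that e by (auto simp: edge_boundary_def)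
      ultimately show "e \<in> edge_boundary E S"
        using S by (auto simp: edge_boundary_def)
    qed
    then show ?thesis using S by blast
  qed
  have "card F \<le> k" if F: "finite F" "F \<subseteq> ?b" for F
  proof -
    obtain S where S: "S \<in> \<S>" "F \<subseteq> edge_boundary E S" using sub[OF F] by (elim bexE)
    then have "card F \<le> card (edge_boundary E S)"
      using t by (intro card_mono) (auto simp: tight_def finite_cut_def)
    then show ?thesis using t S by fastforce
  qed
  then have fin: "finite ?b" "card ?b \<le> k"
    using finite_if_finite_subsets_card_bdd[of ?b k] by auto
  obtain S where S: "S \<in> \<S>" "?b \<subseteq> edge_boundary E S" using sub[OF fin(1) order_refl] by (elim bexE)
  obtain \<eta> where \<eta>: "finite_cut S" "S \<inter> Y = {}" "\<eta> \<in> edge_ends V E" "lives \<eta> S"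
    and min: "\<And>B. finite_cut B \<Longrightarrow> B \<inter> Y = {} \<Longrightarrow> lives \<eta> B \<Longrightarrow>
       card (edge_boundary E S) \<le> card (edge_boundary E B)"
    using t[OF S(1)] unfolding tight_def by blast
  have "card ?b \<le> card (edge_boundary E S)"
    using S \<eta> by (intro card_mono) (auto simp: finite_cut_def)
  moreover have "lives \<eta> (\<Union>\<S>)" using \<eta> S lives_mono by blast
  moreover have "\<Union>\<S> \<subseteq> V" "\<Union>\<S> \<inter> Y = {}"
    using t by (fastforce simp: tight_def finite_cut_def)+
  ultimately show ?thesis
    using fin \<eta> min unfolding tight_def finite_cut_def by (meson order_trans)
qed

text \<open>A disjoint family of tight cuts is encoded as the partial equivalence relation whose classes
  are its members; refinement of families then becomes inclusion of relations.\<close>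

definition tight_rel :: "'v set \<Rightarrow> nat \<Rightarrow> ('v \<times> 'v) set \<Rightarrow> bool" where
  "tight_rel Y k R \<longleftrightarrow> sym R \<and> trans R \<and>
     (\<forall>v\<in>Domain R. tight Y (R `` {v}) \<and> card (edge_boundary E (R `` {v})) \<le> k)"

text \<open>Inclusion of relations lets an extension enlarge and merge classes, as the argument
  requires: a minimum cut for an uncaptured end is uncrossed from the finitely many classes crossing
  it, and the result becomes a class of a larger relation, against maximality.\<close>

lemma tight_rel_extend:
  assumes R0: "tight_rel Y k R0"
  shows "\<exists>R. tight_rel Y k R \<and> R0 \<subseteq> R \<and>
    (\<forall>\<omega>\<in>edge_ends V E. (\<exists>A. finite_cut A \<and> A \<inter> Y = {} \<and> lives \<omega> A \<and> card (edge_boundary E A) \<le> k)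
       \<longrightarrow> (\<exists>v. lives \<omega> (R `` {v})))"
proof -
  define \<A> where "\<A> = {R. tight_rel Y k R \<and> R0 \<subseteq> R}"
  have "\<exists>M\<in>\<A>. \<forall>X\<in>\<A>. M \<subseteq> X \<longrightarrow> X = M"
  proof (rule subset_Zorn_nonempty)
    show "\<A> \<noteq> {}" using R0 by (auto simp: \<A>_def)
  next
    fix \<C> assume ne: "\<C> \<noteq> {}" and ch: "subset.chain \<A> \<C>"
    have C: "\<And>R. R \<in> \<C> \<Longrightarrow> tight_rel Y k R \<and> R0 \<subseteq> R"
      and lin: "\<And>R T. R \<in> \<C> \<Longrightarrow> T \<in> \<C> \<Longrightarrow> R \<subseteq> T \<or> T \<subseteq> R"
      using ch by (auto simp: subset_chain_def \<A>_def)
    have "sym (\<Union>\<C>)"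
    proof (rule symI)
      fix x y assume "(x, y) \<in> \<Union>\<C>"
      then obtain R where "R \<in> \<C>" "(x, y) \<in> R" by blast
      moreover from this have "sym R" using C by (simp add: tight_rel_def)
      ultimately show "(y, x) \<in> \<Union>\<C>" by (blast dest: symD)
    qed
    moreover have "trans (\<Union>\<C>)"
    proof (rule transI)
      fix x y z assume "(x, y) \<in> \<Union>\<C>" "(y, z) \<in> \<Union>\<C>"
      then obtain R T where "R \<in> \<C>" "T \<in> \<C>" "(x, y) \<in> R" "(y, z) \<in> T" by blast
      then obtain W where W: "W \<in> \<C>" "(x, y) \<in> W" "(y, z) \<in> W" using lin[of R T] by blast
      moreover have "trans W" using C[OF W(1)] by (simp add: tight_rel_def)
      ultimately show "(x, z) \<in> \<Union>\<C>" by (blast dest: transD)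
    qed
    moreover have "tight Y ((\<Union>\<C>) `` {v}) \<and> card (edge_boundary E ((\<Union>\<C>) `` {v})) \<le> k"
      if v: "v \<in> Domain (\<Union>\<C>)" for v
    proof -
      let ?\<S> = "(\<lambda>R. R `` {v}) ` {R \<in> \<C>. v \<in> Domain R}"
      have "(\<Union>\<C>) `` {v} = \<Union>?\<S>" by auto
      moreover have "tight Y (\<Union>?\<S>) \<and> card (edge_boundary E (\<Union>?\<S>)) \<le> k"
      proof (rule tight_Union_chain)
        show "S \<subseteq> T \<or> T \<subseteq> S" if "S \<in> ?\<S>" "T \<in> ?\<S>" for S T
        proof -
          obtain R Q where "R \<in> \<C>" "Q \<in> \<C>" "S = R `` {v}" "T = Q `` {v}" using \<open>S \<in> ?\<S>\<close> \<open>T \<in> ?\<S>\<close> by blast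
          then show ?thesis using lin[of R Q] by blast
        qed
        show "?\<S> \<noteq> {}" using v by blast
        show "tight Y S \<and> card (edge_boundary E S) \<le> k" if "S \<in> ?\<S>" for S
          using that C unfolding tight_rel_def by blast
      qed
      ultimately show ?thesis by simp
    qed
    moreover have "R0 \<subseteq> \<Union>\<C>" using ne C by blast
    ultimately show "\<Union>\<C> \<in> \<A>" by (simp add: \<A>_def tight_rel_def)
  qed
  then obtain R where RA: "R \<in> \<A>" and maxA: "\<forall>X\<in>\<A>. R \<subseteq> X \<longrightarrow> X = R" by (elim bexE)
  have R: "tight_rel Y k R" "R0 \<subseteq> R" using RA by (auto simp: \<A>_def)
  have max: "R' = R" if "tight_rel Y k R'" "R \<subseteq> R'" for R'
  proof -
    have "R' \<in> \<A>" using that R by (auto simp: \<A>_def)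
    then show ?thesis using maxA that by simp
  qed
  have symR: "sym R" and transR: "trans R"
    and cl: "\<And>v. v \<in> Domain R \<Longrightarrow> tight Y (R `` {v}) \<and> card (edge_boundary E (R `` {v})) \<le> k"
    using R by (auto simp: tight_rel_def)
  have class_eq: "R `` {u} = R `` {v}" if "(u, v) \<in> R" for u v
    using that symR transR by (auto dest: symD transD)
  define \<P> where "\<P> = (\<lambda>v. R `` {v}) ` Domain R"
  have disj: "disjoint \<P>"
    unfolding disjoint_def
  proof (intro ballI impI)
    fix S T assume "S \<in> \<P>" "T \<in> \<P>" "S \<noteq> T"
    then obtain u v where uv: "S = R `` {u}" "T = R `` {v}" by (auto simp: \<P>_def)
    show "S \<inter> T = {}"
    proof (rule ccontr)
      assume "S \<inter> T \<noteq> {}"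
      then obtain w where "(u, w) \<in> R" "(v, w) \<in> R" using uv by auto
      then show False using class_eq uv \<open>S \<noteq> T\<close> by metis
    qed
  qed
  have tightP: "tight Y S" if "S \<in> \<P>" for S
    using that cl by (auto simp: \<P>_def)
  have "\<exists>v. lives \<omega> (R `` {v})"
    if \<omega>: "\<omega> \<in> edge_ends V E" and A: "finite_cut A" "A \<inter> Y = {}" "lives \<omega> A" "card (edge_boundary E A) \<le> k"
    for \<omega> A
  proof (rule ccontr)
    assume no: "\<not> ?thesis"
    obtain S where S: "finite_cut S" "S \<inter> Y = {}" "lives \<omega> S"
        "card (edge_boundary E S) \<le> card (edge_boundary E A)"
      and min: "\<And>B. finite_cut B \<Longrightarrow> B \<inter> Y = {} \<Longrightarrow> lives \<omega> B \<Longrightarrow>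
         card (edge_boundary E S) \<le> card (edge_boundary E B)"
      using exists_tight[OF \<omega> A(1-3)] by blast
    let ?X = "{T \<in> \<P>. T \<inter> S \<noteq> {} \<and> T - S \<noteq> {}}"
    have "\<exists>A'. finite_cut A' \<and> A' \<inter> Y = {} \<and> lives \<omega> A' \<and>
           card (edge_boundary E A') \<le> card (edge_boundary E S) \<and>
           A' - \<Union>?X = S - \<Union>?X \<and> (\<forall>T\<in>?X. T \<subseteq> A' \<or> T \<inter> A' = {})"
    proof (rule tight_uncross_finite)
      show "finite ?X" using finite_crossing[OF S(1) disj tightP] .
      show "disjoint ?X" using disj by (auto simp: disjoint_def)
      show "tight Y T \<and> \<not> lives \<omega> T" if "T \<in> ?X" for T
        using that tightP no by (auto simp: \<P>_def)
    qed (use S \<omega> in auto)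
    then obtain B where B: "finite_cut B" "B \<inter> Y = {}" "lives \<omega> B"
        "card (edge_boundary E B) \<le> card (edge_boundary E S)"
        "B - \<Union>?X = S - \<Union>?X" "\<forall>T\<in>?X. T \<subseteq> B \<or> T \<inter> B = {}"
      by (elim exE conjE) (rule that)
    \<comment> \<open>Classes that do not cross \<open>S\<close> are disjoint from the crossing
      ones, and only inside the latter can \<open>B\<close> differ from \<open>S\<close>.\<close>
    have nested: "T \<subseteq> B \<or> T \<inter> B = {}" if T: "T \<in> \<P>" for T
    proof (cases "T \<in> ?X")
      case False
      then have TS: "T \<subseteq> S \<or> T \<inter> S = {}" using T by blast
      have "T \<inter> T' = {}" if "T' \<in> ?X" for T'
      proof -
        have T': "T' \<in> \<P>" using that by simp
        have ne: "T \<noteq> T'" using that False by metis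
        show ?thesis by (rule disjointD[OF disj T T' ne])
      qed
      then have "T \<inter> \<Union>?X = {}" by (simp add: Int_Union)
      moreover have "T \<inter> W = {} \<Longrightarrow> B - W = S - W \<Longrightarrow> T \<inter> B = T \<inter> S" for W
        by blast
      ultimately have "T \<inter> B = T \<inter> S" using B(5) by simp
      then show ?thesis using TS by blast
    qed (use B in blast)
    have tightB: "tight Y B"
      using B \<omega> min unfolding tight_def by (meson order_trans)
    have nestedR: "(u, v) \<in> R \<Longrightarrow> u \<in> B \<longleftrightarrow> v \<in> B" for u v
    proof -
      assume uv: "(u, v) \<in> R"
      then have "u \<in> R `` {u}" "v \<in> R `` {u}" "R `` {u} \<in> \<P>"
        using symR transR by (auto simp: \<P>_def dest: symD transD)
      then show "u \<in> B \<longleftrightarrow> v \<in> B" using nested[of "R `` {u}"] by blast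
    qed
    \<comment> \<open>By \<open>nestedR\<close> the set \<open>B\<close> consists of whole classes
      and of vertices in no class, so it becomes one class and the classes outside it stay the
      same.\<close>
    let ?R = "R \<union> B \<times> B"
    have "sym ?R" using symR by (auto simp: sym_def)
    moreover have "trans ?R"
      using transR nestedR by (intro transI) (auto dest: transD)
    moreover have "tight Y (?R `` {v}) \<and> card (edge_boundary E (?R `` {v})) \<le> k"
      if "v \<in> Domain ?R" for v
    proof (cases "v \<in> B")
      case True
      then have "?R `` {v} = B" using nestedR by auto
      then show ?thesis using tightB B(4) S(4) A(4) by simp
    next
      case False
      then have "?R `` {v} = R `` {v}" "v \<in> Domain R" using that by auto
      then show ?thesis using cl by simp
    qed
    ultimately have "tight_rel Y k ?R" by (simp add: tight_rel_def)
    then have "?R = R" using max[of ?R] by blast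
    moreover obtain b where "b \<in> B" using lives_nonempty[OF \<omega> B(3)] by blast
    ultimately have "B \<subseteq> R `` {b}" by blast
    then show False using no lives_mono[OF B(3)] by blast
  qed
  then show ?thesis using R by blast
qed

lemma tight_rel_mono: "tight_rel Y k R \<Longrightarrow> k \<le> l \<Longrightarrow> tight_rel Y l R"
  unfolding tight_rel_def by (meson order_trans)

text \<open>The stages are nested so that the class of a vertex only grows, and they start with the
  empty relation so that the first stage capturing an end is a successor.\<close>

lemma tight_rel_chain:
  "\<exists>R. R 0 = {} \<and> (\<forall>k. tight_rel Y k (R k)) \<and> (\<forall>k l. k \<le> l \<longrightarrow> R k \<subseteq> R l) \<and>
    (\<forall>\<omega>\<in>edge_ends V E. \<forall>A. finite_cut A \<and> A \<inter> Y = {} \<and> lives \<omega> A \<longrightarrow> (\<exists>k v. lives \<omega> (R k `` {v})))"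
proof -
  let ?cov = "\<lambda>k R. \<forall>\<omega>\<in>edge_ends V E. (\<exists>A. finite_cut A \<and> A \<inter> Y = {} \<and> lives \<omega> A \<and> card (edge_boundary E A) \<le> k)
       \<longrightarrow> (\<exists>v. lives \<omega> (R `` {v}))"
  have "\<exists>R. \<forall>n. (tight_rel Y n (R n) \<and> (n = 0 \<longrightarrow> R n = {})) \<and> (R n \<subseteq> R (Suc n) \<and> ?cov (Suc n) (R (Suc n)))"
  proof (rule dependent_nat_choice)
    show "\<exists>x. tight_rel Y 0 x \<and> (0 = 0 \<longrightarrow> x = {})"
      by (auto simp: tight_rel_def sym_def trans_def)
    fix x n assume "tight_rel Y n x \<and> (n = 0 \<longrightarrow> x = {})"
    then have "tight_rel Y (Suc n) x" using tight_rel_mono[of Y n x "Suc n"] by simp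
    from tight_rel_extend[OF this]
    show "\<exists>y. (tight_rel Y (Suc n) y \<and> (Suc n = 0 \<longrightarrow> y = {})) \<and> (x \<subseteq> y \<and> ?cov (Suc n) y)"
      by blast
  qed
  then obtain R where R': "\<forall>n. (tight_rel Y n (R n) \<and> (n = 0 \<longrightarrow> R n = {})) \<and> (R n \<subseteq> R (Suc n) \<and> ?cov (Suc n) (R (Suc n)))"
    by (elim exE)
  have R: "\<And>n. tight_rel Y n (R n)" "R 0 = {}" "\<And>n. R n \<subseteq> R (Suc n)" "\<And>n. ?cov (Suc n) (R (Suc n))"
    using R' by simp_all
  have "R k \<subseteq> R l" if "k \<le> l" for k l
    using R(3) that by (rule lift_Suc_mono_le)
  \<comment> \<open>Coverage is known at successor stages only, so a cut with \<open>k\<close>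
    boundary edges is handled at stage \<open>Suc k\<close>.\<close>
  moreover have "\<exists>k v. lives \<omega> (R k `` {v})"
    if "\<omega> \<in> edge_ends V E" "finite_cut A" "A \<inter> Y = {}" "lives \<omega> A" for \<omega> A
    using R(4)[of "card (edge_boundary E A)"] that by (meson le_SucI order_refl)
  ultimately show ?thesis
    using R by (intro exI[of _ R]) blast
qed

lemma avoiding_partition:
  obtains \<P> where "disjoint \<P>" "\<And>P. P \<in> \<P> \<Longrightarrow> finite_cut P \<and> P \<inter> Y = {}"
    "\<And>\<omega> A. \<omega> \<in> edge_ends V E \<Longrightarrow> finite_cut A \<Longrightarrow> A \<inter> Y = {} \<Longrightarrow> lives \<omega> A
       \<Longrightarrow> \<exists>P\<in>\<P>. lives \<omega> P"
proof -
  obtain R where R': "R 0 = {} \<and> (\<forall>k. tight_rel Y k (R k)) \<and> (\<forall>k l. k \<le> l \<longrightarrow> R k \<subseteq> R l) \<and>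
      (\<forall>\<omega>\<in>edge_ends V E. \<forall>A. finite_cut A \<and> A \<inter> Y = {} \<and> lives \<omega> A \<longrightarrow> (\<exists>k v. lives \<omega> (R k `` {v})))"
    using tight_rel_chain[of Y] by (elim exE)
  then have R0: "R 0 = {}" and R: "tight_rel Y k (R k)" and mono: "k \<le> l \<Longrightarrow> R k \<subseteq> R l" for k l
    by simp_all
  have cov: "\<exists>k v. lives \<omega> (R k `` {v})"
    if "\<omega> \<in> edge_ends V E" "finite_cut A" "A \<inter> Y = {}" "lives \<omega> A" for \<omega> A
    using conjunct2[OF conjunct2[OF conjunct2[OF R']]] that by blast
  have symR: "sym (R k)" and transR: "trans (R k)" for k
    using R by (auto simp: tight_rel_def)
  have cls: "finite_cut (R k `` {v}) \<and> R k `` {v} \<inter> Y = {}" for k v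
  proof (cases "v \<in> Domain (R k)")
    case True
    then show ?thesis using R[of k] unfolding tight_rel_def tight_def by blast
  next
    case False
    then have "R k `` {v} = {}" by blast
    then show ?thesis by simp
  qed
  define Q where "Q = (\<Union>k. R k)"
  have symQ: "(v, u) \<in> Q" if "(u, v) \<in> Q" for u v
    using that symR unfolding Q_def by (blast dest: symD)
  have transQ: "(u, w) \<in> Q" if uv: "(u, v) \<in> Q" and vw: "(v, w) \<in> Q" for u v w
  proof -
    obtain k l where "(u, v) \<in> R k" "(v, w) \<in> R l" using uv vw by (auto simp: Q_def)
    then have "(u, v) \<in> R (max k l)" "(v, w) \<in> R (max k l)"
      using mono[of k "max k l"] mono[of l "max k l"] by auto
    then show ?thesis using transR unfolding Q_def by (blast dest: transD)
  qed
  \<comment> \<open>The choice depends only on the class of \<open>v\<close> in the limit relation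
    \<open>Q\<close>, so related vertices obtain the same representative.\<close>
  define rep where "rep v = (SOME w. (v, w) \<in> Q)" for v
  have rep: "(v, rep v) \<in> Q" if "(v, w) \<in> Q" for v w
    unfolding rep_def using that by (rule someI)
  have rep_eq: "rep u = rep v" if "(u, v) \<in> Q" for u v
  proof -
    have "(u, w) \<in> Q \<longleftrightarrow> (v, w) \<in> Q" for w
      using that symQ transQ by blast
    then show ?thesis by (simp add: rep_def)
  qed
  \<comment> \<open>The classes of a point may grow through infinitely many stages; telescoping the growth at one
    representative per limit class keeps every piece a difference of two finite cuts.\<close>
  define piece where "piece w k = R (Suc k) `` {w} - R k `` {w}" for w k
  define \<P> where "\<P> = {piece w k | w k. w \<in> rep ` Domain Q}"
  show ?thesis
  proof
    show "disjoint \<P>"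
      unfolding disjoint_def
    proof (intro ballI impI)
      fix S T assume ST: "S \<in> \<P>" "T \<in> \<P>" "S \<noteq> T"
      then obtain u v k l where uv: "u \<in> rep ` Domain Q" "v \<in> rep ` Domain Q"
        "S = piece u k" "T = piece v l"
        unfolding \<P>_def by (elim CollectE exE conjE) (rule that)
      show "S \<inter> T = {}"
      proof (rule ccontr)
        assume "S \<inter> T \<noteq> {}"
        then obtain w where w: "w \<in> S" "w \<in> T" by blast
        have "(u, w) \<in> Q" "(v, w) \<in> Q" using w uv by (auto simp: Q_def piece_def)
        moreover obtain u' v' where u': "u = rep u'" "u' \<in> Domain Q" "v = rep v'" "v' \<in> Domain Q" using uv by blast
        moreover have "(u', u) \<in> Q" "(v', v) \<in> Q" using u' rep by auto
        ultimately have "u = v" using rep_eq symQ transQ by metis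
        moreover have "k = l"
        proof (rule ccontr)
          assume "k \<noteq> l"
          then consider "Suc k \<le> l" | "Suc l \<le> k" by linarith
          then show False
          proof cases
            case 1
            then show ?thesis using w uv \<open>u = v\<close> mono[of "Suc k" l] by (auto simp: piece_def)
          next
            case 2
            then show ?thesis using w uv \<open>u = v\<close> mono[of "Suc l" k] by (auto simp: piece_def)
          qed
        qed
        ultimately show False using uv ST by simp
      qed
    qed
    show "finite_cut P \<and> P \<inter> Y = {}" if "P \<in> \<P>" for P
      using that cls unfolding \<P>_def piece_def by (auto intro: finite_cut_Diff)
    fix \<omega> A assume \<omega>: "\<omega> \<in> edge_ends V E" and A: "finite_cut A" "A \<inter> Y = {}" "lives \<omega> A"
    obtain k v where kv: "lives \<omega> (R k `` {v})" using cov[OF \<omega> A] by blast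
    then obtain u where "(v, u) \<in> R k" using lives_nonempty[OF \<omega> kv] by blast
    then have v: "v \<in> Domain Q" "(v, rep v) \<in> Q" using rep by (auto simp: Q_def)
    then obtain l where l: "(v, rep v) \<in> R l" by (auto simp: Q_def)
    \<comment> \<open>A class of \<open>v\<close> is contained in a class of its representative once
      the stage is late enough to relate the two.\<close>
    have "R k `` {v} \<subseteq> R (max k l) `` {rep v}"
    proof
      fix w assume "w \<in> R k `` {v}"
      then have "(v, w) \<in> R (max k l)" "(v, rep v) \<in> R (max k l)"
        using l mono[of k "max k l"] mono[of l "max k l"] by auto
      then show "w \<in> R (max k l) `` {rep v}"
        using symR transR by (blast dest: symD transD)
    qed
    then have ex: "lives \<omega> (R (max k l) `` {rep v})" using kv lives_mono by blast
    \<comment> \<open>Since \<open>R 0\<close> is empty, the least stage is some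
      \<open>Suc j\<close>, and \<open>\<omega>\<close> lives in the growth from stage
      \<open>j\<close> to stage \<open>Suc j\<close>.\<close>
    define m where "m = (LEAST m. lives \<omega> (R m `` {rep v}))"
    have m: "lives \<omega> (R m `` {rep v})" unfolding m_def using ex by (rule LeastI)
    have "m \<noteq> 0"
    proof
      assume "m = 0"
      then show False using m R0 lives_nonempty[OF \<omega>, of "{}"] by simp
    qed
    then obtain j where j: "m = Suc j" by (cases m) auto
    have "\<not> lives \<omega> (R j `` {rep v})" using not_less_Least[of j "\<lambda>m. lives \<omega> (R m `` {rep v})"] j unfolding m_def by simp
    then have "lives \<omega> (piece (rep v) j)"
      using m j \<omega> cls by (simp add: lives_Diff piece_def)
    moreover have "piece (rep v) j \<in> \<P>" using v by (auto simp: \<P>_def)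
    ultimately show "\<exists>P\<in>\<P>. lives \<omega> P" by blast
  qed
qed

end

section \<open>Ultrametrics and convergence\<close>

text \<open>The values \<open>s n x\<close> label the parts of a refining sequence of partitions,
  and the distance of two points is the power of 1/2 given by the first level separating them.
  Assumption \<open>conv\<close> bundles completeness with a neighbourhood base at the
  limit.\<close>

lemma completely_ultrametrizable_spaceI:
  fixes X :: "'a topology" and s :: "nat \<Rightarrow> 'a \<Rightarrow> 'b"
  assumes refine: "\<And>n x y. x \<in> topspace X \<Longrightarrow> y \<in> topspace X \<Longrightarrow> s (Suc n) x = s (Suc n) y \<Longrightarrow> s n x = s n y"
    and opn: "\<And>n x. x \<in> topspace X \<Longrightarrow> openin X {y \<in> topspace X. s n y = s n x}"
    and t1: "t1_space X"
    and conv: "\<And>x. (\<And>n. x n \<in> topspace X) \<Longrightarrow> (\<And>n. s n (x (Suc n)) = s n (x n)) \<Longrightarrow>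
       \<exists>p\<in>topspace X. (\<forall>n. s n p = s n (x n)) \<and>
         (\<forall>U. openin X U \<and> p \<in> U \<longrightarrow> (\<exists>n. {y \<in> topspace X. s n y = s n p} \<subseteq> U))"
  shows "completely_ultrametrizable_space X"
proof -
  let ?M = "topspace X"
  define d :: "'a \<Rightarrow> 'a \<Rightarrow> real"
    where "d x y = (if x = y then 0 else (1/2) ^ (LEAST n. s n x \<noteq> s n y))" for x y
  have anti: "s m x = s m y" if "m \<le> n" "s n x = s n y" "x \<in> ?M" "y \<in> ?M" for m n x y
    using that by (induction rule: inc_induct) (auto intro: refine)
  have base: "\<exists>n. {y \<in> ?M. s n y = s n p} \<subseteq> U" if U: "openin X U" "p \<in> U" for p U
  proof -
    have p: "p \<in> ?M" using openin_subset U by blast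
    \<comment> \<open>For the constant sequence at \<open>p\<close> the limit \<open>p'\<close>
      shares all labels with \<open>p\<close>, and the T1 property forces
      \<open>p' = p\<close>.\<close>
    then obtain p' where p': "p' \<in> ?M" "\<And>n. s n p' = s n p"
      and bs: "\<And>U. openin X U \<Longrightarrow> p' \<in> U \<Longrightarrow> \<exists>n. {y \<in> ?M. s n y = s n p'} \<subseteq> U"
      using conv[of "\<lambda>_. p"] by auto
    have "p' = p"
    proof (rule ccontr)
      assume "p' \<noteq> p"
      then obtain W where W: "openin X W" "p' \<in> W" "p \<notin> W"
        using t1 p p'(1) unfolding t1_space_def by blast
      obtain n where "{y \<in> ?M. s n y = s n p'} \<subseteq> W" using bs[OF W(1,2)] by blast
      then show False using p p'(2)[of n] W by auto
    qed
    then show ?thesis using bs U by blast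
  qed
  have sep: "\<exists>n. s n x \<noteq> s n y" if xy: "x \<in> ?M" "y \<in> ?M" "x \<noteq> y" for x y
  proof -
    obtain W where W: "openin X W" "x \<in> W" "y \<notin> W"
      using t1 xy unfolding t1_space_def by blast
    obtain n where "{z \<in> ?M. s n z = s n x} \<subseteq> W" using base[OF W(1,2)] by blast
    then have "s n y \<noteq> s n x" using xy W by blast
    then show ?thesis by metis
  qed
  have d_less: "d x y < (1/2) ^ n \<longleftrightarrow> s n x = s n y" if xy: "x \<in> ?M" "y \<in> ?M" for x y n
  proof (cases "x = y")
    case False
    define L where "L = (LEAST n. s n x \<noteq> s n y)"
    have L: "s L x \<noteq> s L y"
      unfolding L_def by (rule LeastI_ex) (rule sep[OF xy False])
    have lt: "s m x = s m y" if "m < L" for m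
      using not_less_Least[of m "\<lambda>n. s n x \<noteq> s n y"] that unfolding L_def by blast
    have "d x y < (1/2) ^ n \<longleftrightarrow> n < L"
      using False by (simp add: d_def L_def[symmetric] power_strict_decreasing_iff)
    also have "\<dots> \<longleftrightarrow> s n x = s n y"
    proof
      show "n < L \<Longrightarrow> s n x = s n y" by (rule lt)
      show "n < L" if eq: "s n x = s n y"
      proof (rule ccontr)
        assume "\<not> n < L"
        then have "s L x = s L y" using anti[of L n, OF _ eq xy] by simp
        then show False using L by simp
      qed
    qed
    finally show ?thesis .
  qed (simp add: d_def)
  have nonneg: "0 \<le> d x y" for x y
    by (simp add: d_def)
  have comm: "d x y = d y x" for x y
  proof -
    have "(LEAST n. s n x \<noteq> s n y) = (LEAST n. s n y \<noteq> s n x)"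
      by (rule arg_cong[where f = Least]) auto
    then show ?thesis by (simp add: d_def)
  qed
  have ultra: "d x z \<le> max (d x y) (d y z)" if "x \<in> ?M" "y \<in> ?M" "z \<in> ?M" for x y z
  proof (cases "x = z")
    case True
    then show ?thesis using nonneg[of x y] by (simp add: d_def le_max_iff_disj)
  next
    case False
    define L where "L = (LEAST n. s n x \<noteq> s n z)"
    have L: "s L x \<noteq> s L z"
      unfolding L_def by (rule LeastI_ex) (rule sep[OF that(1,3) False])
    then have "s L x \<noteq> s L y \<or> s L y \<noteq> s L z" by metis
    then have "(1/2) ^ L \<le> d x y \<or> (1/2) ^ L \<le> d y z"
      using d_less[OF that(1,2), of L] d_less[OF that(2,3), of L] by linarith
    then show ?thesis using False by (simp add: d_def[of x z] L_def[symmetric] le_max_iff_disj)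
  qed
  interpret Metric_space ?M d
  proof
    fix x y z assume xyz: "x \<in> ?M" "y \<in> ?M" "z \<in> ?M"
    show "d x z \<le> d x y + d y z"
      using ultra[OF xyz] nonneg[of x y] nonneg[of y z] by linarith
  next
    fix x y :: 'a
    show "(d x y = 0) = (x = y)" by (simp add: d_def)
  qed (rule nonneg comm)+
  have ball_eq: "mball x ((1/2) ^ n) = {y \<in> ?M. s n y = s n x}" if "x \<in> ?M" for x n
    using that d_less by (auto simp: in_mball)
  have small: "\<exists>n. (1/2::real) ^ n < e" if "e > 0" for e
    using that by (intro real_arch_pow_inv) auto
  have "X = mtopology"
    unfolding topology_eq openin_mtopology
  proof (intro allI iffI conjI impI)
    fix U assume U: "openin X U"
    then show "U \<subseteq> ?M" by (rule openin_subset)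
    fix x assume x: "x \<in> U"
    then obtain n where "{y \<in> ?M. s n y = s n x} \<subseteq> U" using base[OF U] by blast
    then show "\<exists>r>0. mball x r \<subseteq> U"
      using ball_eq[of x n] x \<open>U \<subseteq> ?M\<close> by (intro exI[of _ "(1/2) ^ n"]) auto
  next
    fix U assume U: "U \<subseteq> ?M \<and> (\<forall>x. x \<in> U \<longrightarrow> (\<exists>r>0. mball x r \<subseteq> U))"
    show "openin X U"
    proof (subst openin_subopen, intro ballI)
      fix x assume x: "x \<in> U"
      then obtain r where r: "r > 0" "mball x r \<subseteq> U" using U by blast
      obtain n where n: "(1/2::real) ^ n < r" using small r by blast
      have xM: "x \<in> ?M" using x U by blast
      have "mball x ((1/2) ^ n) \<subseteq> U" using r n mball_subset_concentric[of "(1/2) ^ n" r x] by auto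
      then show "\<exists>T. openin X T \<and> x \<in> T \<and> T \<subseteq> U"
        using opn[OF xM, of n] ball_eq[OF xM, of n] xM
        by (intro exI[of _ "{y \<in> ?M. s n y = s n x}"]) auto
    qed
  qed
  moreover have mcomplete
    unfolding mcomplete_def
  proof (intro allI impI)
    fix \<sigma> assume \<sigma>: "MCauchy \<sigma>"
    then have M: "\<sigma> n \<in> ?M" for n by (auto simp: MCauchy_def)
    have "\<forall>k. \<exists>N. \<forall>n n'. N \<le> n \<longrightarrow> N \<le> n' \<longrightarrow> d (\<sigma> n) (\<sigma> n') < (1/2) ^ k"
      using \<sigma> by (auto simp: MCauchy_def)
    then obtain N where N: "\<And>k n n'. N k \<le> n \<Longrightarrow> N k \<le> n' \<Longrightarrow> d (\<sigma> n) (\<sigma> n') < (1/2) ^ k"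
      using choice[of "\<lambda>k N. \<forall>n n'. N \<le> n \<longrightarrow> N \<le> n' \<longrightarrow> d (\<sigma> n) (\<sigma> n') < (1/2) ^ k"] by blast
    \<comment> \<open>Partial sums dominate \<open>N\<close> and are increasing, so the points at
      the indices \<open>K k\<close> satisfy the compatibility condition of
      \<open>conv\<close>.\<close>
    define K where "K k = (\<Sum>i\<le>k. N i)" for k
    have K: "N k \<le> K k" "K k \<le> K (Suc k)" for k
      unfolding K_def by (auto intro: member_le_sum)
    have agree: "s k (\<sigma> n) = s k (\<sigma> (K k))" if "K k \<le> n" for k n
      using N[of k n "K k"] K[of k] that d_less[OF M M] by simp
    obtain p where p: "p \<in> ?M" "\<And>n. s n p = s n (\<sigma> (K n))"
      using conv[of "\<lambda>k. \<sigma> (K k)"] M agree K(2) by blast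
    have "limitin mtopology \<sigma> p sequentially"
      unfolding limitin_metric
    proof (intro conjI allI impI)
      fix \<epsilon> :: real assume "\<epsilon> > 0"
      then obtain k where k: "(1/2::real) ^ k < \<epsilon>" using small by blast
      have "d (\<sigma> n) p < \<epsilon>" if "K k \<le> n" for n
        using d_less[OF M p(1), of n k] agree[OF that] p(2)[of k] k by simp
      then show "\<forall>\<^sub>F n in sequentially. \<sigma> n \<in> ?M \<and> d (\<sigma> n) p < \<epsilon>"
        unfolding eventually_sequentially using M by blast
    qed (rule p)
    then show "\<exists>x. limitin mtopology \<sigma> x sequentially" ..
  qed
  ultimately show ?thesis
    unfolding completely_ultrametrizable_space_def
    using Metric_space_axioms ultra by blast
qed

context conn_graph
begin

text \<open>Move from each vertex \<open>v\<close> along a shortest path inside its deepest region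
  \<open>D (lev v)\<close> towards the next region. Each step raises the level, or keeps it and
  shortens the distance; so no vertex repeats, and the level is unbounded because a distance cannot
  decrease forever.\<close>

lemma ray_through_regions:
  assumes reg: "\<And>i::nat. region V E (D i)" and dec: "\<And>i. D (Suc i) \<subseteq> D i"
    and van: "\<And>v. v \<in> V \<Longrightarrow> \<exists>i. v \<notin> D i"
  shows "\<exists>r. ray V E r \<and> (\<forall>i. \<forall>\<^sub>F n in sequentially. r n \<in> D i)"
proof -
  have anti: "D j \<subseteq> D i" if "i \<le> j" for i j
    using dec that by (rule lift_Suc_antimono_le)
  have DV: "D i \<subseteq> V" for i using reg by (simp add: region_def)
  \<comment> \<open>The index of the last region containing \<open>v\<close>, for
    \<open>v \<in> D 0\<close>; it exists because the regions decrease and lose every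
    vertex.\<close>
  define lev where "lev v = (LEAST i. v \<notin> D (Suc i))" for v
  have lev1: "v \<notin> D (Suc (lev v))" if v: "v \<in> D 0" for v
  proof -
    obtain i where "v \<notin> D i" using van DV v by blast
    then have "v \<notin> D (Suc i)" using dec by blast
    then show ?thesis unfolding lev_def by (rule LeastI)
  qed
  have lev_le: "i \<le> lev v" if "v \<in> D i" for v i
  proof (rule ccontr)
    assume "\<not> i \<le> lev v"
    then have "D i \<subseteq> D (Suc (lev v))" by (intro anti) simp
    moreover have "v \<in> D 0" using that anti[of 0 i] by blast
    ultimately show False using lev1 that by blast
  qed
  have lev2: "v \<in> D (lev v)" if v: "v \<in> D 0" for v
  proof (cases "lev v")
    case (Suc j)
    then have "j < (LEAST i. v \<notin> D (Suc i))" unfolding lev_def by simp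
    then have "v \<in> D (Suc j)" using not_less_Least[of j "\<lambda>i. v \<notin> D (Suc i)"] by blast
    then show ?thesis using Suc by simp
  qed (use v in simp)
  define A where "A i = arcs {e \<in> E. e \<subseteq> D i}" for i
  define dist where "dist v = (LEAST n. \<exists>u\<in>D (Suc (lev v)). (v, u) \<in> A (lev v) ^^ n)" for v
  have dist_ex: "\<exists>u\<in>D (Suc (lev v)). (v, u) \<in> A (lev v) ^^ dist v" if v: "v \<in> D 0" for v
  proof -
    obtain u where u: "u \<in> D (Suc (lev v))"
      using reg[of "Suc (lev v)"] unfolding region_def by blast
    then have "u \<in> D (lev v)" using dec by blast
    then have "(v, u) \<in> (A (lev v))\<^sup>*"
      using reg[of "lev v"] lev2[OF v] by (simp add: region_def A_def reachable_iff_rtrancl)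
    then obtain n where "(v, u) \<in> A (lev v) ^^ n" using rtrancl_imp_relpow by blast
    then have "\<exists>n. \<exists>u\<in>D (Suc (lev v)). (v, u) \<in> A (lev v) ^^ n" using u by blast
    then show ?thesis unfolding dist_def by (rule LeastI_ex)
  qed
  define closer where "closer w v \<longleftrightarrow> lev v < lev w \<or> (lev w = lev v \<and> dist w < dist v)" for w v
  have step: "\<exists>w. {v, w} \<in> E \<and> w \<in> D 0 \<and> closer w v" if v: "v \<in> D 0" for v
  proof -
    obtain u where u: "u \<in> D (Suc (lev v))" "(v, u) \<in> A (lev v) ^^ dist v"
      using dist_ex[OF v] by blast
    have "dist v \<noteq> 0"
    proof
      assume "dist v = 0"
      then show False using u lev1[OF v] by simp
    qed
    then obtain m where m: "dist v = Suc m" by (cases "dist v") auto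
    then obtain w where w: "(v, w) \<in> A (lev v)" "(w, u) \<in> A (lev v) ^^ m"
      using u(2) relpow_Suc_D2 by (metis (no_types))
    then have e: "{v, w} \<in> E" "w \<in> D (lev v)" by (auto simp: A_def arcs_def)
    have "dist w < dist v" if "lev w = lev v"
    proof -
      have "dist w \<le> m"
        unfolding dist_def that using u(1) w(2) by (intro Least_le) blast
      then show ?thesis using m by simp
    qed
    then have "closer w v"
      using lev_le[OF e(2)] by (auto simp: closer_def)
    moreover have "w \<in> D 0" using e anti[of 0 "lev v"] by blast
    ultimately show ?thesis using e by blast
  qed
  then obtain f where f: "\<And>v. v \<in> D 0 \<Longrightarrow> {v, f v} \<in> E \<and> f v \<in> D 0 \<and> closer (f v) v"
    using bchoice[of "D 0" "\<lambda>v w. {v, w} \<in> E \<and> w \<in> D 0 \<and> closer w v"] by blast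
  obtain v0 where v0: "v0 \<in> D 0" using reg[of 0] by (auto simp: region_def)
  define r where "r n = (f ^^ n) v0" for n
  have rD: "r n \<in> D 0" for n
    by (induction n) (use f v0 in \<open>auto simp: r_def\<close>)
  have rs: "{r n, r (Suc n)} \<in> E" "closer (r (Suc n)) (r n)" for n
    using f[OF rD[of n]] by (auto simp: r_def)
  have closer_trans: "closer u v \<Longrightarrow> closer v w \<Longrightarrow> closer u w" for u v w
    by (auto simp: closer_def)
  have less: "closer (r n) (r m)" if "m < n" for m n
    using that
  proof (induction n rule: less_Suc_induct)
    case (1 i)
    show ?case by (rule rs)
  qed (blast intro: closer_trans)
  have "inj r"
  proof (rule linorder_injI)
    fix m n :: nat assume "m < n"
    then show "r m \<noteq> r n" using less[of m n] by (auto simp: closer_def)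
  qed
  moreover have "r n \<in> V" for n using rD[of n] DV[of 0] by blast
  ultimately have ray: "ray V E r" using rs(1) by (simp add: ray_def)
  have lev_mono: "lev (r m) \<le> lev (r n)" if "m \<le> n" for m n
    using less[of m n] that by (cases "m = n") (auto simp: closer_def)
  have grow: "\<exists>m. lev (r n) < lev (r m)" for n
  proof (induction "dist (r n)" arbitrary: n rule: less_induct)
    case less
    show ?case
    proof (cases "lev (r n) < lev (r (Suc n))")
      case False
      then have "dist (r (Suc n)) < dist (r n)" "lev (r (Suc n)) = lev (r n)"
        using rs(2)[of n] by (auto simp: closer_def)
      then show ?thesis using less[of "Suc n"] by simp
    qed blast
  qed
  have reach: "\<exists>n. i \<le> lev (r n)" for i
  proof (induction i)
    case (Suc i)
    then obtain n where "i \<le> lev (r n)" by blast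
    moreover obtain m where "lev (r n) < lev (r m)" using grow by blast
    ultimately have "Suc i \<le> lev (r m)" by simp
    then show ?case by blast
  qed simp
  have "\<forall>\<^sub>F n in sequentially. r n \<in> D i" for i
  proof -
    obtain N where N: "i \<le> lev (r N)" using reach by blast
    have "r n \<in> D i" if "n \<ge> N" for n
      using lev2[OF rD[of n]] anti[of i "lev (r n)"] N lev_mono[OF that] by auto
    then show ?thesis unfolding eventually_sequentially by blast
  qed
  then show ?thesis using ray by blast
qed

section \<open>Dominated ends\<close>

definition dominated :: "'v set \<Rightarrow> (nat \<Rightarrow> 'v) set \<Rightarrow> bool" where
  "dominated Y \<omega> \<longleftrightarrow> \<omega> \<in> edge_ends V E \<and> (\<forall>A. finite_cut A \<and> lives \<omega> A \<longrightarrow> A \<inter> Y \<noteq> {})"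

text \<open>Cuts avoiding single vertices can be intersected. So an end dominated by a finite set is
  dominated by one of its vertices.\<close>

lemma finite_avoiding_cut:
  assumes "finite Y" "\<omega> \<in> edge_ends V E" "\<And>y. y \<in> Y \<Longrightarrow> \<exists>A. finite_cut A \<and> lives \<omega> A \<and> y \<notin> A"
  shows "\<exists>A. finite_cut A \<and> lives \<omega> A \<and> A \<inter> Y = {}"
  using assms(1,3)
proof (induction Y rule: finite_induct)
  case empty
  then show ?case using finite_cut_V lives_V[OF assms(2)] by blast
next
  case (insert y Y)
  have "\<exists>A. finite_cut A \<and> lives \<omega> A \<and> A \<inter> Y = {}"
    by (rule insert.IH) (use insert.prems in blast)
  then obtain A where A: "finite_cut A" "lives \<omega> A" "A \<inter> Y = {}" by blast
  obtain B where B: "finite_cut B" "lives \<omega> B" "y \<notin> B" using insert.prems[of y] by blast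
  show ?case
    using A B by (intro exI[of _ "A \<inter> B"]) (auto simp: finite_cut_Int lives_Int)
qed

text \<open>Assign to each such end a vertex of \<open>Y\<close> lying in all cuts around it.
  Distinct ends are separated by a cut and its complement, so they get different vertices.\<close>

lemma finite_dominated:
  assumes "finite Y"
  shows "finite {\<omega>. dominated Y \<omega>}"
proof -
  have "\<exists>y. y \<in> Y \<and> (\<forall>A. finite_cut A \<and> lives \<omega> A \<longrightarrow> y \<in> A)" if \<omega>: "dominated Y \<omega>" for \<omega>
  proof (rule ccontr)
    assume no: "\<not> ?thesis"
    have "\<exists>A. finite_cut A \<and> lives \<omega> A \<and> A \<inter> Y = {}"
      by (rule finite_avoiding_cut[OF assms]) (use \<omega> no in \<open>auto simp: dominated_def\<close>)
    then show False using \<omega> by (auto simp: dominated_def)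
  qed
  then obtain f where f: "\<And>\<omega>. dominated Y \<omega> \<Longrightarrow> f \<omega> \<in> Y"
      "\<And>\<omega> A. dominated Y \<omega> \<Longrightarrow> finite_cut A \<Longrightarrow> lives \<omega> A \<Longrightarrow> f \<omega> \<in> A"
    using choice[of "\<lambda>\<omega> y. dominated Y \<omega> \<longrightarrow> y \<in> Y \<and> (\<forall>A. finite_cut A \<and> lives \<omega> A \<longrightarrow> y \<in> A)"]
    by blast
  have "inj_on f {\<omega>. dominated Y \<omega>}"
  proof (rule inj_onI, rule ccontr)
    fix \<omega> \<eta> assume "\<omega> \<in> {\<omega>. dominated Y \<omega>}" "\<eta> \<in> {\<omega>. dominated Y \<omega>}" and eq: "f \<omega> = f \<eta>" "\<omega> \<noteq> \<eta>"
    then have dm: "dominated Y \<omega>" "dominated Y \<eta>" and en: "\<omega> \<in> edge_ends V E" "\<eta> \<in> edge_ends V E"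
      by (auto simp: dominated_def)
    obtain A where A: "finite_cut A" "lives \<omega> A" "\<not> lives \<eta> A"
      using ends_separated[OF en eq(2)] by blast
    have "f \<omega> \<in> A" using f(2)[OF dm(1) A(1,2)] .
    moreover have "f \<eta> \<in> V - A"
      using f(2)[OF dm(2) finite_cut_compl[OF A(1)]] lives_compl[OF en(2) A(1)] A(3) by blast
    ultimately show False using eq by simp
  qed
  moreover have "f ` {\<omega>. dominated Y \<omega>} \<subseteq> Y" using f(1) by blast
  ultimately show ?thesis using assms by (rule inj_on_finite)
qed

text \<open>Intersecting \<open>D\<close> with the pieces of \<open>avoiding_partition\<close> and
  passing to components keeps the sets disjoint. As no end in \<open>D\<close> is dominated, each
  has a cut avoiding \<open>Y\<close> and is therefore captured.\<close>

lemma region_partition: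
  assumes D: "finite_cut D" and nd: "\<And>\<omega>. lives \<omega> D \<Longrightarrow> \<not> dominated Y \<omega>"
  shows "\<exists>\<Q>. disjoint \<Q> \<and> (\<forall>C\<in>\<Q>. region V E C \<and> C \<subseteq> D \<and> C \<inter> Y = {}) \<and>
    (\<forall>\<omega>\<in>edge_ends V E. lives \<omega> D \<longrightarrow> (\<exists>C\<in>\<Q>. lives \<omega> C))"
proof -
  obtain \<P> where \<P>: "disjoint \<P>" "\<And>P. P \<in> \<P> \<Longrightarrow> finite_cut P \<and> P \<inter> Y = {}"
    and cov: "\<And>\<omega> A. \<omega> \<in> edge_ends V E \<Longrightarrow> finite_cut A \<Longrightarrow> A \<inter> Y = {} \<Longrightarrow> lives \<omega> A
       \<Longrightarrow> \<exists>P\<in>\<P>. lives \<omega> P"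
    using avoiding_partition[of Y] by blast
  define \<Q> where "\<Q> = (\<Union>P\<in>\<P>. graph_components (D \<inter> P))"
  have cutDP: "finite_cut (D \<inter> P)" if "P \<in> \<P>" for P
    using \<P>(2)[OF that] D by (simp add: finite_cut_Int)
  have "disjoint \<Q>"
  proof (rule disjointI, rule ccontr)
    fix C C' assume C: "C \<in> \<Q>" "C' \<in> \<Q>" "C \<noteq> C'" "C \<inter> C' \<noteq> {}"
    then obtain P P' where P: "P \<in> \<P>" "C \<in> graph_components (D \<inter> P)"
        "P' \<in> \<P>" "C' \<in> graph_components (D \<inter> P')"
      by (auto simp: \<Q>_def)
    have "C \<subseteq> P" "C' \<subseteq> P'" using P component_subset by fast+
    then have "P \<inter> P' \<noteq> {}" using C by blast
    then have "P = P'" using disjointD[OF \<P>(1) P(1,3)] by blast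
    then show False using disjoint_components P C by metis
  qed
  moreover have "region V E C \<and> C \<subseteq> D \<and> C \<inter> Y = {}" if C: "C \<in> \<Q>" for C
  proof -
    obtain P where P: "P \<in> \<P>" "C \<in> graph_components (D \<inter> P)" using C by (auto simp: \<Q>_def)
    show ?thesis
      using component_region[OF cutDP[OF P(1)] P(2)] component_subset[OF P(2)] \<P>(2)[OF P(1)] by blast
  qed
  moreover have "\<exists>C\<in>\<Q>. lives \<omega> C" if \<omega>: "\<omega> \<in> edge_ends V E" "lives \<omega> D" for \<omega>
  proof -
    obtain A where "finite_cut A" "lives \<omega> A" "A \<inter> Y = {}"
      using nd[OF \<omega>(2)] \<omega>(1) by (auto simp: dominated_def)
    then obtain P where P: "P \<in> \<P>" "lives \<omega> P" using cov[OF \<omega>(1)] by blast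
    then have "lives \<omega> (D \<inter> P)" using \<omega> by (simp add: lives_Int)
    then obtain C where "C \<in> graph_components (D \<inter> P)" "lives \<omega> C"
      using lives_component[OF \<omega>(1) cutDP[OF P(1)]] by blast
    then show ?thesis using P by (auto simp: \<Q>_def)
  qed
  ultimately show ?thesis by (intro exI[of _ \<Q>]) blast
qed

text \<open>Inside each member of a countable base around \<open>\<omega>\<close> there is a finite
  cut around \<open>\<omega>\<close>; successive intersections make these cuts decreasing. The
  enumeration may repeat members, which also covers finite bases.\<close>

lemma first_countable_cut_base:
  assumes fc: "first_countable (edge_end_space V E)" and \<omega>: "\<omega> \<in> edge_ends V E"
  shows "\<exists>b :: nat \<Rightarrow> 'v set. (\<forall>n. finite_cut (b n) \<and> lives \<omega> (b n) \<and> b (Suc n) \<subseteq> b n) \<and>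
    (\<forall>U. openin (edge_end_space V E) U \<and> \<omega> \<in> U \<longrightarrow> (\<exists>n. \<forall>\<eta>\<in>edge_ends V E. lives \<eta> (b n) \<longrightarrow> \<eta> \<in> U))"
proof -
  let ?X = "edge_end_space V E"
  obtain \<B> where \<B>: "countable \<B>" "\<And>W. W \<in> \<B> \<Longrightarrow> openin ?X W"
    and bs: "\<And>U. openin ?X U \<Longrightarrow> \<omega> \<in> U \<Longrightarrow> \<exists>W\<in>\<B>. \<omega> \<in> W \<and> W \<subseteq> U"
    using fc \<omega> unfolding first_countable_def by (metis topspace_edge_end_space)
  define \<B>' where "\<B>' = {W \<in> \<B>. \<omega> \<in> W}"
  have ne: "\<B>' \<noteq> {}"
    using bs[OF openin_topspace] \<omega> by (auto simp: \<B>'_def)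
  have cnt: "countable \<B>'" using \<B>(1) by (simp add: \<B>'_def)
  have "\<exists>A. finite_cut A \<and> lives \<omega> A \<and> (\<forall>\<eta>\<in>edge_ends V E. lives \<eta> A \<longrightarrow> \<eta> \<in> from_nat_into \<B>' n)" for n
  proof -
    have "from_nat_into \<B>' n \<in> \<B>'" using ne by (rule from_nat_into)
    then have "openin ?X (from_nat_into \<B>' n)" "\<omega> \<in> from_nat_into \<B>' n"
      using \<B>(2) by (auto simp: \<B>'_def)
    then show ?thesis unfolding openin_edge_end_space by blast
  qed
  then obtain A where A: "\<And>n. finite_cut (A n) \<and> lives \<omega> (A n) \<and>
      (\<forall>\<eta>\<in>edge_ends V E. lives \<eta> (A n) \<longrightarrow> \<eta> \<in> from_nat_into \<B>' n)"
    using choice[of "\<lambda>n A. finite_cut A \<and> lives \<omega> A \<and> (\<forall>\<eta>\<in>edge_ends V E. lives \<eta> A \<longrightarrow> \<eta> \<in> from_nat_into \<B>' n)"]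
    by blast
  define b where "b = rec_nat (A 0) (\<lambda>n B. B \<inter> A (Suc n))"
  have b0: "b 0 = A 0" and bS: "b (Suc n) = b n \<inter> A (Suc n)" for n
    by (simp_all add: b_def)
  have bA: "b n \<subseteq> A n" for n
    by (cases n) (auto simp: b0 bS)
  have "finite_cut (b n) \<and> lives \<omega> (b n)" for n
    by (induction n) (use A in \<open>auto simp: b0 bS finite_cut_Int lives_Int\<close>)
  moreover have "\<exists>n. \<forall>\<eta>\<in>edge_ends V E. lives \<eta> (b n) \<longrightarrow> \<eta> \<in> U" if U: "openin ?X U" "\<omega> \<in> U" for U
  proof -
    obtain W where W: "W \<in> \<B>'" "W \<subseteq> U" using bs[OF U] by (auto simp: \<B>'_def)
    then obtain n where n: "from_nat_into \<B>' n = W" using from_nat_into_surj[OF cnt] by blast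
    have "\<eta> \<in> U" if "\<eta> \<in> edge_ends V E" "lives \<eta> (b n)" for \<eta>
      using A[of n] that n W lives_mono[OF that(2) bA] by blast
    then show ?thesis by blast
  qed
  ultimately show ?thesis by (intro exI[of _ b]) (simp add: bS)
qed

end

section \<open>First countable edge-end spaces\<close>

context conn_graph
begin

definition dominated_in :: "'v set \<times> 'v set \<Rightarrow> (nat \<Rightarrow> 'v) set set" where
  "dominated_in q = {\<omega>. dominated (snd q) \<omega> \<and> lives \<omega> (fst q)}"

text \<open>The choice depends on \<open>q\<close> only through the set
  \<open>dominated_in q\<close>. Once this set is stationary, the same end is split off at all later
  stages.\<close>

definition pivot :: "'v set \<times> 'v set \<Rightarrow> (nat \<Rightarrow> 'v) set" where
  "pivot q = (SOME \<omega>. \<omega> \<in> dominated_in q)"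

text \<open>A state is a finite cut together with a finite set of vertices that the final pieces have to
  avoid. The ends dominated by these vertices obstruct this, so as long as there are any, one of
  them is separated from the rest of the cut along its countable neighbourhood base \<open>b\<close>.\<close>

definition splitting ::
  "((nat \<Rightarrow> 'v) set \<Rightarrow> nat \<Rightarrow> 'v set) \<Rightarrow> nat \<Rightarrow> 'v set \<times> 'v set \<Rightarrow> ('v set \<times> 'v set) set \<Rightarrow> bool" where
  "splitting b n q Q \<longleftrightarrow>
     (\<forall>p\<in>Q. finite_cut (fst p) \<and> finite (snd p) \<and> fst p \<subseteq> fst q \<and> snd q \<subseteq> snd p) \<and>
     (\<forall>p\<in>Q. \<forall>p'\<in>Q. fst p \<inter> fst p' \<noteq> {} \<longrightarrow> p = p') \<and>
     (\<forall>\<omega>\<in>edge_ends V E. lives \<omega> (fst q) \<longrightarrow> (\<exists>p\<in>Q. lives \<omega> (fst p))) \<and>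
     (\<forall>p\<in>Q. (dominated_in q \<noteq> {} \<and> snd p = snd q \<and>
               (lives (pivot q) (fst p) \<longrightarrow> fst p \<subseteq> b (pivot q) n)) \<or>
            (region V E (fst p) \<and> fst p \<inter> snd q = {} \<and> \<Union> (edge_boundary E (fst p)) \<subseteq> snd p))"

lemma splittingD:
  assumes "splitting b n q Q" "p \<in> Q"
  shows "finite_cut (fst p)" "finite (snd p)" "fst p \<subseteq> fst q" "snd q \<subseteq> snd p"
    "(dominated_in q \<noteq> {} \<and> snd p = snd q \<and>
        (lives (pivot q) (fst p) \<longrightarrow> fst p \<subseteq> b (pivot q) n)) \<or>
     (region V E (fst p) \<and> fst p \<inter> snd q = {} \<and> \<Union> (edge_boundary E (fst p)) \<subseteq> snd p)"
  using assms unfolding splitting_def by simp_all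

lemma splitting_unique:
  "splitting b n q Q \<Longrightarrow> p \<in> Q \<Longrightarrow> p' \<in> Q \<Longrightarrow> fst p \<inter> fst p' \<noteq> {} \<Longrightarrow> p = p'"
  unfolding splitting_def by simp

lemma splitting_cover:
  "splitting b n q Q \<Longrightarrow> \<omega> \<in> edge_ends V E \<Longrightarrow> lives \<omega> (fst q) \<Longrightarrow> \<exists>p\<in>Q. lives \<omega> (fst p)"
  unfolding splitting_def by simp

lemma pivot_in: "dominated_in q \<noteq> {} \<Longrightarrow> pivot q \<in> dominated_in q"
  unfolding pivot_def by (rule someI_ex) blast

text \<open>With no dominated end in \<open>D\<close>, the cut is refined into regions avoiding
  \<open>Y\<close>, and their boundary endpoints join the vertices to be avoided. Otherwise
  \<open>D\<close> is divided by the base cut of the pivot, and \<open>Y\<close> is kept so that the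
  set of dominated ends can only shrink.\<close>

lemma splitting_exists:
  assumes D: "finite_cut D" and Y: "finite Y"
    and b: "\<And>\<omega>. \<omega> \<in> edge_ends V E \<Longrightarrow> finite_cut (b \<omega> n) \<and> lives \<omega> (b \<omega> n)"
  shows "\<exists>Q. splitting b n (D, Y) Q"
proof (cases "dominated_in (D, Y) = {}")
  case True
  have "\<not> dominated Y \<omega>" if "lives \<omega> D" for \<omega>
    using True that by (auto simp: dominated_in_def)
  then obtain \<Q> where \<Q>: "disjoint \<Q>" "\<forall>C\<in>\<Q>. region V E C \<and> C \<subseteq> D \<and> C \<inter> Y = {}"
      "\<forall>\<omega>\<in>edge_ends V E. lives \<omega> D \<longrightarrow> (\<exists>C\<in>\<Q>. lives \<omega> C)"
    using region_partition[OF D, of Y] by blast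
  define Q where "Q = (\<lambda>C. (C, Y \<union> \<Union> (edge_boundary E C))) ` \<Q>"
  have "finite (\<Union> (edge_boundary E C))" if "region V E C" for C
    using that finite_edge boundary_subset by (intro finite_Union) (auto simp: region_def)
  moreover have "p = p'" if pQ: "p \<in> Q" "p' \<in> Q" and ne: "fst p \<inter> fst p' \<noteq> {}" for p p'
  proof -
    obtain C C' where "C \<in> \<Q>" "C' \<in> \<Q>" "p = (C, Y \<union> \<Union> (edge_boundary E C))"
        "p' = (C', Y \<union> \<Union> (edge_boundary E C'))"
      using pQ unfolding Q_def by blast
    then show ?thesis using disjointD[OF \<Q>(1), of C C'] ne by (cases "C = C'") auto
  qed
  ultimately have "splitting b n (D, Y) Q"
    using \<Q>(2,3) Y region_imp_finite_cut unfolding splitting_def Q_def by auto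
  then show ?thesis ..
next
  case False
  let ?\<delta> = "pivot (D, Y)"
  let ?B = "b ?\<delta> n"
  have \<delta>: "?\<delta> \<in> edge_ends V E" "lives ?\<delta> D"
    using pivot_in[OF False] by (auto simp: dominated_in_def dominated_def)
  have B: "finite_cut ?B" "lives ?\<delta> ?B" using b[OF \<delta>(1)] by auto
  let ?Q = "{(D \<inter> ?B, Y), (D - ?B, Y)}"
  have "\<not> lives ?\<delta> (D - ?B)" using \<delta> B D by (simp add: lives_Diff)
  moreover have "lives \<omega> (D \<inter> ?B) \<or> lives \<omega> (D - ?B)" if "\<omega> \<in> edge_ends V E" "lives \<omega> D" for \<omega>
    using that B D by (auto simp: lives_Diff lives_Int)
  ultimately have "splitting b n (D, Y) ?Q"
    using False Y finite_cut_Int[OF D B(1)] finite_cut_Diff[OF D B(1)] unfolding splitting_def by auto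
  then show ?thesis ..
qed

theorem first_countable_imp_completely_ultrametrizable:
  assumes fc: "first_countable (edge_end_space V E)"
  shows "completely_ultrametrizable_space (edge_end_space V E)"
proof -
  let ?X = "edge_end_space V E" and ?\<Omega> = "edge_ends V E"
  define base where "base \<omega> c \<longleftrightarrow>
     (\<forall>n. finite_cut (c n) \<and> lives \<omega> (c n) \<and> c (Suc n) \<subseteq> c n) \<and>
     (\<forall>U. openin ?X U \<and> \<omega> \<in> U \<longrightarrow> (\<exists>n. \<forall>\<eta>\<in>?\<Omega>. lives \<eta> (c n) \<longrightarrow> \<eta> \<in> U))"
    for \<omega> and c :: "nat \<Rightarrow> 'v set"
  define b where "b \<omega> = (SOME c. base \<omega> c)" for \<omega>
  have "base \<omega> (b \<omega>)" if "\<omega> \<in> ?\<Omega>" for \<omega>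
  proof -
    have "\<exists>c. base \<omega> c" using first_countable_cut_base[OF fc that] by (simp add: base_def)
    then show ?thesis unfolding b_def by (rule someI_ex)
  qed
  then have b: "finite_cut (b \<omega> n)" "lives \<omega> (b \<omega> n)" "b \<omega> (Suc n) \<subseteq> b \<omega> n"
    and b_base: "openin ?X U \<Longrightarrow> \<omega> \<in> U \<Longrightarrow> \<exists>n. \<forall>\<eta>\<in>?\<Omega>. lives \<eta> (b \<omega> n) \<longrightarrow> \<eta> \<in> U"
    if "\<omega> \<in> ?\<Omega>" for \<omega> n U
    using that unfolding base_def by simp_all
  \<comment> \<open>One family is fixed per level and state, so that ends sharing a state are
    subdivided by the same partition.\<close>
  define ch where "ch n q = (SOME Q. splitting b n q Q)" for n q
  have ch: "splitting b n q (ch n q)" if "finite_cut (fst q)" "finite (snd q)" for n q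
  proof -
    have "\<exists>Q. splitting b n q Q" using splitting_exists[OF that, of b n] b by simp
    then show ?thesis unfolding ch_def by (rule someI_ex)
  qed
  \<comment> \<open>A reference vertex, avoided by every region formed later: a vertex in all these
    regions would be joined to \<open>x0\<close> by a path crossing all their boundaries.\<close>
  obtain x0 where x0: "x0 \<in> V" using conn by (auto simp: connected_graph_def)
  define s where "s n \<omega> = rec_nat (V, {x0}) (\<lambda>n q. SOME p. p \<in> ch n q \<and> lives \<omega> (fst p)) n" for n \<omega>
  have s0: "s 0 \<omega> = (V, {x0})" and sS: "s (Suc n) \<omega> = (SOME p. p \<in> ch n (s n \<omega>) \<and> lives \<omega> (fst p))" for n \<omega>
    by (simp_all add: s_def)
  have next_state: "s (Suc n) \<omega> \<in> ch n (s n \<omega>) \<and> lives \<omega> (fst (s (Suc n) \<omega>))"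
    if "finite_cut (fst (s n \<omega>))" "finite (snd (s n \<omega>))" "lives \<omega> (fst (s n \<omega>))" "\<omega> \<in> ?\<Omega>" for n \<omega>
  proof -
    have "\<exists>p. p \<in> ch n (s n \<omega>) \<and> lives \<omega> (fst p)"
      using splitting_cover[OF ch[OF that(1,2), of n] that(4,3)] by blast
    then show ?thesis unfolding sS by (rule someI_ex)
  qed
  have state: "finite_cut (fst (s n \<omega>)) \<and> finite (snd (s n \<omega>)) \<and> lives \<omega> (fst (s n \<omega>))"
    if \<omega>: "\<omega> \<in> ?\<Omega>" for n \<omega>
  proof (induction n)
    case 0
    then show ?case using lives_V[OF \<omega>] by (simp add: s0)
  next
    case (Suc n)
    then have st: "finite_cut (fst (s n \<omega>))" "finite (snd (s n \<omega>))" "lives \<omega> (fst (s n \<omega>))"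
      by auto
    note nx = next_state[OF st \<omega>]
    show ?case
      using splittingD[OF ch[OF st(1,2)], of "s (Suc n) \<omega>" n] nx by simp
  qed
  have sS_in: "s (Suc n) \<omega> \<in> ch n (s n \<omega>)" if "\<omega> \<in> ?\<Omega>" for n \<omega>
    using next_state[of n \<omega>] state[OF that, of n] that by simp
  have split: "splitting b n (s n \<omega>) (ch n (s n \<omega>))" if "\<omega> \<in> ?\<Omega>" for n \<omega>
    using ch[of "s n \<omega>" n] state[OF that, of n] by simp
  have s_dec: "fst (s (Suc n) \<omega>) \<subseteq> fst (s n \<omega>)" if "\<omega> \<in> ?\<Omega>" for n \<omega>
    by (rule splittingD(3)[OF split[OF that] sS_in[OF that]])
  \<comment> \<open>Disjointness within each family lets the piece determine the state: living in
    the piece of \<open>\<omega>\<close> at level \<open>n\<close> forces the same choices at all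
    levels up to \<open>n\<close>.\<close>
  have same: "s n \<eta> = s n \<omega>" if \<omega>: "\<omega> \<in> ?\<Omega>" and \<eta>: "\<eta> \<in> ?\<Omega>" and l: "lives \<eta> (fst (s n \<omega>))" for n \<omega> \<eta>
    using l
  proof (induction n)
    case (Suc n)
    have eq: "s n \<eta> = s n \<omega>" by (rule Suc.IH[OF lives_mono[OF Suc.prems s_dec[OF \<omega>]]])
    have "lives \<eta> (fst (s (Suc n) \<eta>))" using state[OF \<eta>, of "Suc n"] by simp
    then have "fst (s (Suc n) \<eta>) \<inter> fst (s (Suc n) \<omega>) \<noteq> {}"
      using lives_disjoint[OF \<eta> _ Suc.prems] by simp
    moreover have "s (Suc n) \<eta> \<in> ch n (s n \<omega>)" using sS_in[OF \<eta>, of n] eq by simp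
    ultimately show ?case
      using splitting_unique[OF split[OF \<omega>] _ sS_in[OF \<omega>]] by simp
  qed (simp add: s0)
  have same_iff: "s n \<eta> = s n \<omega> \<longleftrightarrow> lives \<eta> (fst (s n \<omega>))"
    if \<omega>: "\<omega> \<in> ?\<Omega>" and \<eta>: "\<eta> \<in> ?\<Omega>" for n \<omega> \<eta>
  proof
    show "lives \<eta> (fst (s n \<omega>))" if "s n \<eta> = s n \<omega>"
      using state[OF \<eta>, of n] that by simp
  qed (rule same[OF \<omega> \<eta>])
  show ?thesis
  proof (rule completely_ultrametrizable_spaceI[where s = s], unfold topspace_edge_end_space)
    fix n \<omega> \<eta> assume \<omega>: "\<omega> \<in> ?\<Omega>" and \<eta>: "\<eta> \<in> ?\<Omega>" and eq: "s (Suc n) \<omega> = s (Suc n) \<eta>"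
    have "lives \<omega> (fst (s (Suc n) \<eta>))" using state[OF \<omega>, of "Suc n"] eq by simp
    then have "lives \<omega> (fst (s n \<eta>))" using lives_mono s_dec[OF \<eta>] by simp
    then show "s n \<omega> = s n \<eta>" by (rule same[OF \<eta> \<omega>])
  next
    fix n \<omega> assume \<omega>: "\<omega> \<in> ?\<Omega>"
    have "{\<eta> \<in> ?\<Omega>. s n \<eta> = s n \<omega>} = {\<eta> \<in> ?\<Omega>. lives \<eta> (fst (s n \<omega>))}"
      using same_iff[OF \<omega>] by blast
    then show "openin ?X {\<eta> \<in> ?\<Omega>. s n \<eta> = s n \<omega>}"
      using openin_lives state[OF \<omega>, of n] by simp
  next
    show "t1_space ?X"
      unfolding t1_space_def topspace_edge_end_space
    proof (intro ballI impI)
      fix \<omega> \<eta> assume "\<omega> \<in> ?\<Omega>" "\<eta> \<in> ?\<Omega>" "\<omega> \<noteq> \<eta>"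
      then obtain A where A: "finite_cut A" "lives \<omega> A" "\<not> lives \<eta> A" using ends_separated by blast
      then show "\<exists>U. openin ?X U \<and> \<omega> \<in> U \<and> \<eta> \<notin> U"
        using openin_lives[OF A(1)] \<open>\<omega> \<in> ?\<Omega>\<close> by (intro exI[of _ "{\<omega> \<in> ?\<Omega>. lives \<omega> A}"]) simp
    qed
  next
    fix x assume x: "\<And>n. x n \<in> ?\<Omega>" and coh: "\<And>n. s n (x (Suc n)) = s n (x n)"
    define q where "q n = s n (x n)" for n
    define D where "D n = fst (q n)" for n
    define Y where "Y n = snd (q n)" for n
    have fin: "finite_cut (D n)" "finite (Y n)" "lives (x n) (D n)" for n
      using state[OF x, of n n] by (auto simp: D_def Y_def q_def)
    have spl: "splitting b n (q n) (ch n (q n))" for n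
      using split[OF x, of n n] by (simp add: q_def)
    have qS: "q (Suc n) \<in> ch n (q n)" for n
      using sS_in[OF x, of n "Suc n"] coh[of n] by (simp add: q_def)
    have DS: "D (Suc n) \<subseteq> D n" and YS: "Y n \<subseteq> Y (Suc n)" for n
      using splittingD(3,4)[OF spl qS] by (simp_all add: D_def Y_def)
    \<comment> \<open>The alternative of \<open>splitting\<close> in which regions avoiding
      \<open>Y n\<close> are formed. At all other stages a pivot is split off and \<open>Y\<close>
      stays the same.\<close>
    define refining where "refining n \<longleftrightarrow>
      region V E (D (Suc n)) \<and> D (Suc n) \<inter> Y n = {} \<and> \<Union> (edge_boundary E (D (Suc n))) \<subseteq> Y (Suc n)" for n
    have pivoting: "dominated_in (q n) \<noteq> {} \<and> Y (Suc n) = Y n \<and>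
        (lives (pivot (q n)) (D (Suc n)) \<longrightarrow> D (Suc n) \<subseteq> b (pivot (q n)) n)" if "\<not> refining n" for n
      using splittingD(5)[OF spl[of n] qS[of n]] that by (auto simp: refining_def D_def Y_def)
    have D_anti: "D n \<subseteq> D m" if "m \<le> n" for m n
      using DS that by (rule lift_Suc_antimono_le)
    have Y_mono: "Y m \<subseteq> Y n" if "m \<le> n" for m n
      using YS that by (rule lift_Suc_mono_le)
    have "\<exists>p\<in>?\<Omega>. (\<forall>n. lives p (D n)) \<and>
       (\<forall>A. openin ?X A \<and> p \<in> A \<longrightarrow> (\<exists>n. \<forall>\<eta>\<in>?\<Omega>. lives \<eta> (D n) \<longrightarrow> \<eta> \<in> A))"
    proof (cases "\<exists>N. \<forall>n\<ge>N. \<not> refining n")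
      case True
      then obtain N where N: "\<And>n. n \<ge> N \<Longrightarrow> \<not> refining n" by blast
      \<comment> \<open>From \<open>N\<close> on the avoided set is constant, so the finite sets of
        dominated ends decrease and are stationary from some \<open>K\<close> on. Thereafter one end
        \<open>p\<close> is always the pivot, and the cuts follow its base.\<close>
      have Yc: "Y n = Y N" if "n \<ge> N" for n
        using that by (induction n rule: dec_induct) (use pivoting N in auto)
      have dd: "dominated_in (q n) = {\<omega>. dominated (Y N) \<omega> \<and> lives \<omega> (D n)}" if "n \<ge> N" for n
        using Yc[OF that] by (simp add: dominated_in_def D_def Y_def)
      have fd: "finite (dominated_in (q n))" if "n \<ge> N" for n
        unfolding dd[OF that] using finite_dominated[OF fin(2)[of N]] by (rule finite_subset[rotated]) blast
      obtain K where K: "K \<ge> N" "\<And>n. n \<ge> N \<Longrightarrow> card (dominated_in (q K)) \<le> card (dominated_in (q n))"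
        using ex_has_least_nat[of "\<lambda>n. n \<ge> N" N "\<lambda>n. card (dominated_in (q n))"] by blast
      have const: "dominated_in (q n) = dominated_in (q K)" if "n \<ge> K" for n
      proof (rule card_seteq)
        show "dominated_in (q n) \<subseteq> dominated_in (q K)"
          using dd[of n] dd[of K] K(1) that lives_mono[OF _ D_anti[OF that]] by auto
      qed (use fd K that in auto)
      define p where "p = pivot (q K)"
      have piv: "pivot (q n) = p" if "n \<ge> K" for n
        using const[OF that] by (simp add: p_def pivot_def)
      have "dominated_in (q K) \<noteq> {}" using pivoting N K by blast
      then have pin: "p \<in> dominated_in (q K)" unfolding p_def by (rule pivot_in)
      then have p: "p \<in> ?\<Omega>" using dd[OF K(1)] by (simp add: dominated_def)
      have pK: "lives p (D n)" if "n \<ge> K" for n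
      proof -
        have "p \<in> dominated_in (q n)" using pin const[OF that] by simp
        then show ?thesis using dd[of n] K(1) that by simp
      qed
      have pl: "lives p (D n)" for n
        using lives_mono[OF pK D_anti[of n "max n K"]] by simp
      have Db: "D (Suc n) \<subseteq> b p n" if "n \<ge> K" for n
        using pivoting[of n] N[of n] K(1) that piv[OF that] pl[of "Suc n"] by auto
      have "\<exists>n. \<forall>\<eta>\<in>?\<Omega>. lives \<eta> (D n) \<longrightarrow> \<eta> \<in> A" if A: "openin ?X A" "p \<in> A" for A
      proof -
        obtain m where m: "\<forall>\<eta>\<in>?\<Omega>. lives \<eta> (b p m) \<longrightarrow> \<eta> \<in> A" using b_base[OF p A] by blast
        have "b p (max m K) \<subseteq> b p m" using b(3)[OF p] by (rule lift_Suc_antimono_le) simp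
        then have "D (Suc (max m K)) \<subseteq> b p m" using Db[of "max m K"] by simp
        then show ?thesis using m lives_mono by blast
      qed
      then show ?thesis using p pl by blast
    next
      case False
      then have inf: "infinite {n. refining n}"
        unfolding infinite_nat_iff_unbounded_le by auto
      \<comment> \<open>Boundary endpoints of an earlier region belong to \<open>Y\<close> at all
        later stages and are missed by the later regions.\<close>
      have avoid: "D (Suc n) \<inter> \<Union> (edge_boundary E (D (Suc m))) = {}"
        if "refining m" "refining n" "m < n" for m n
      proof -
        have "\<Union> (edge_boundary E (D (Suc m))) \<subseteq> Y (Suc m)" "D (Suc n) \<inter> Y n = {}"
          using that by (simp_all add: refining_def)
        moreover have "Y (Suc m) \<subseteq> Y n" using Y_mono that(3) by simp
        ultimately show ?thesis by (meson disjoint_iff subsetD)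
      qed
      have x0D: "x0 \<notin> D (Suc n)" if "refining n" for n
      proof -
        have "x0 \<in> Y 0" by (simp add: Y_def q_def s0)
        then have "x0 \<in> Y n" using Y_mono[of 0 n] by blast
        then show ?thesis using that unfolding refining_def by blast
      qed
      \<comment> \<open>A finite path from such a vertex to \<open>x0\<close> would cross the
        boundaries of all regions formed at refining stages; these are infinitely many and pairwise
        disjoint.\<close>
      have vanish: "\<exists>n. v \<notin> D n" if v: "v \<in> V" for v
      proof (rule ccontr)
        assume no: "\<not> ?thesis"
        obtain F where F: "F \<subseteq> E" "finite F" "reachable F v x0"
          using reachable_finite_subset[OF reachable_V[OF v x0]] by blast
        have "\<exists>e. e \<in> F \<and> e \<in> edge_boundary E (D (Suc n))" if "refining n" for n
          using reachable_crossing[OF F(3), of "D (Suc n)"] no x0D[OF that] F(1)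
          by (auto simp: edge_boundary_def)
        then obtain f where f: "\<And>n. refining n \<Longrightarrow> f n \<in> F \<and> f n \<in> edge_boundary E (D (Suc n))"
          using choice[of "\<lambda>n e. refining n \<longrightarrow> e \<in> F \<and> e \<in> edge_boundary E (D (Suc n))"] by blast
        have neq: "f m \<noteq> f n" if "refining m" "refining n" "m < n" for m n
        proof
          assume "f m = f n"
          then have "f n \<in> edge_boundary E (D (Suc m))" "f n \<inter> D (Suc n) \<noteq> {}"
            using f[OF that(1)] f[OF that(2)] by (auto simp: edge_boundary_def)
          then show False using avoid[OF that] by blast
        qed
        have "inj_on f {n. refining n}"
          by (rule linorder_inj_onI) (use neq in auto)
        moreover have "f ` {n. refining n} \<subseteq> F" using f by blast
        ultimately show False using F(2) inf inj_on_finite by blast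
      qed
      \<comment> \<open>The successor appears because \<open>refining n\<close> is a statement about
        \<open>D (Suc n)\<close>.\<close>
      define g where "g i = Suc (enumerate {n. refining n} i)" for i
      have g_mono: "strict_mono g"
        using strict_mono_enumerate[OF inf] by (simp add: g_def strict_mono_def)
      have reg: "region V E (D (g i))" for i
        using enumerate_in_set[OF inf, of i] by (simp add: g_def refining_def)
      have Dg: "D (g i) \<subseteq> D i" for i
        using D_anti seq_suble[OF g_mono] by blast
      have "D (g (Suc i)) \<subseteq> D (g i)" for i
        by (rule D_anti) (use g_mono in \<open>simp add: strict_mono_less_eq\<close>)
      moreover have "\<exists>i. v \<notin> D (g i)" if "v \<in> V" for v
        using vanish[OF that] Dg by blast
      ultimately obtain r where r: "ray V E r" "\<And>i. \<forall>\<^sub>F n in sequentially. r n \<in> D (g i)"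
        using ray_through_regions[of "\<lambda>i. D (g i)", OF reg] by blast
      define p where "p = end_of r"
      have p: "p \<in> ?\<Omega>" using r by (auto simp: p_def edge_ends_eq)
      have pg: "lives p (D (g i))" for i
        unfolding p_def lives_end_of[OF r(1) region_imp_finite_cut[OF reg]] by (rule r)
      have van: "\<forall>\<^sub>F i in sequentially. v \<notin> D (g i)" if v: "v \<in> V" for v
      proof -
        obtain n where n: "v \<notin> D n" using vanish[OF v] by blast
        have "v \<notin> D (g i)" if "i \<ge> n" for i
          using Dg[of i] D_anti[OF that] n by blast
        then show ?thesis unfolding eventually_sequentially by blast
      qed
      have "\<exists>n. \<forall>\<eta>\<in>?\<Omega>. lives \<eta> (D n) \<longrightarrow> \<eta> \<in> A" if A: "openin ?X A" "p \<in> A" for A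
      proof -
        obtain B where B: "finite_cut B" "lives p B" "\<forall>\<eta>\<in>?\<Omega>. lives \<eta> B \<longrightarrow> \<eta> \<in> A"
          using A unfolding openin_edge_end_space by blast
        obtain i where "D (g i) \<subseteq> B"
          using shrinking_regions[of "\<lambda>i. D (g i)", OF reg van p pg B(1,2)]
          unfolding eventually_sequentially by blast
        then show ?thesis using B(3) lives_mono by blast
      qed
      moreover have "lives p (D n)" for n using lives_mono[OF pg Dg] .
      ultimately show ?thesis using p by blast
    qed
    then obtain p where p: "p \<in> ?\<Omega>" and pl: "\<And>n. lives p (D n)"
      and pb: "\<And>A. openin ?X A \<Longrightarrow> p \<in> A \<Longrightarrow> \<exists>n. \<forall>\<eta>\<in>?\<Omega>. lives \<eta> (D n) \<longrightarrow> \<eta> \<in> A"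
      by blast
    have ps: "s n p = s n (x n)" for n
      using same[OF x p, of n n] pl[of n] by (simp add: D_def q_def)
    have cls: "{\<eta> \<in> ?\<Omega>. s n \<eta> = s n p} = {\<eta> \<in> ?\<Omega>. lives \<eta> (D n)}" for n
      unfolding ps using same_iff[OF x, of _ n n] by (auto simp: D_def q_def)
    have "\<exists>n. {\<eta> \<in> ?\<Omega>. s n \<eta> = s n p} \<subseteq> U" if "openin ?X U" "p \<in> U" for U
      using pb[OF that] unfolding cls by blast
    then show "\<exists>p\<in>?\<Omega>. (\<forall>n. s n p = s n (x n)) \<and>
         (\<forall>U. openin ?X U \<and> p \<in> U \<longrightarrow> (\<exists>n. {y \<in> ?\<Omega>. s n y = s n p} \<subseteq> U))"
      using p ps by (intro bexI[of _ p] conjI allI impI) auto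
  qed
qed

end

section \<open>Trees are first countable\<close>

lemma walk_snoc: "xs \<noteq> [] \<Longrightarrow> walk F (xs @ [b]) \<longleftrightarrow> walk F xs \<and> {last xs, b} \<in> F"
  by (induction xs rule: induct_list012) (auto simp: walk_Cons_Cons)

lemma walk_appendD: "walk F (xs @ ys) \<Longrightarrow> xs \<noteq> [] \<Longrightarrow> walk F xs"
  by (induction xs rule: induct_list012) (auto simp: walk_Cons_Cons)

text \<open>A path is extended edge by edge; if the new vertex already occurs, the path is cut back
  to that occurrence.\<close>

lemma reachable_imp_path:
  assumes "reachable F x y"
  shows "\<exists>xs. walk F xs \<and> distinct xs \<and> hd xs = x \<and> last xs = y"
  using assms
proof (induction rule: reachable_induct)
  case refl
  show ?case by (intro exI[of _ "[x]"]) simp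
next
  case (step a b)
  then obtain xs where xs: "walk F xs" "distinct xs" "hd xs = x" "last xs = a" by blast
  have ne: "xs \<noteq> []" using xs by (auto simp: walk_def)
  show ?case
  proof (cases "b \<in> set xs")
    case True
    then obtain ys zs where ys: "xs = ys @ b # zs" by (meson split_list)
    then have "xs = (ys @ [b]) @ zs" by simp
    then have "walk F (ys @ [b])" using xs(1) walk_appendD by (metis snoc_eq_iff_butlast)
    then show ?thesis
      using xs ys by (intro exI[of _ "ys @ [b]"]) (auto simp: hd_append split: if_splits)
  next
    case False
    then show ?thesis
      using xs ne step(2) by (intro exI[of _ "xs @ [b]"]) (auto simp: walk_snoc)
  qed
qed

text \<open>A path from \<open>a\<close> to \<open>b\<close> avoiding the edge would close up with
  it to a cycle. It has at least three vertices, since \<open>a\<close> and \<open>b\<close> differ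
  and a path on two vertices would be the removed edge.\<close>

lemma acyclic_edge_bridge:
  assumes "\<not> has_cycle E" "{a, b} \<in> E" "a \<noteq> b"
  shows "\<not> reachable (E - {{a, b}}) a b"
proof
  assume r: "reachable (E - {{a, b}}) a b"
  obtain xs where xs: "walk (E - {{a, b}}) xs" "distinct xs" "hd xs = a" "last xs = b"
    using reachable_imp_path[OF r] by (elim exE conjE) (rule that)
  have "walk E xs" using xs(1) by (auto simp: walk_def)
  moreover have "{last xs, hd xs} \<in> E" using xs assms(2) by (simp add: insert_commute)
  moreover have "length xs \<ge> 3"
  proof (rule ccontr)
    assume "\<not> length xs \<ge> 3"
    then have "length xs = 0 \<or> length xs = 1 \<or> length xs = 2" by linarith
    then show False
      using xs assms(3) by (auto simp: length_Suc_conv numeral_2_eq_2 walk_def)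
  qed
  ultimately show False using assms(1) xs(2) unfolding has_cycle_def by blast
qed

context conn_graph
begin

text \<open>This is a component left after deleting \<open>F\<close>: walks avoiding
  \<open>F\<close> stay inside it, and every boundary edge belongs to \<open>F\<close>.\<close>

lemma region_reachable:
  assumes F: "F \<subseteq> E" "finite F" and v: "v \<in> V"
  shows "region V E {u. reachable (E - F) v u}"
proof -
  define C where "C = {u. reachable (E - F) v u}"
  have sub: "C \<subseteq> V"
  proof
    fix u assume "u \<in> C"
    then have "reachable (E - F) v u" by (simp add: C_def)
    then show "u \<in> V"
      by (induction rule: reachable_induct) (use v in \<open>auto elim!: edgeE simp: doubleton_eq_iff\<close>)
  qed
  have "reachable {e \<in> E. e \<subseteq> C} v u" if "reachable (E - F) v u" for u
    using that
  proof (induction rule: reachable_induct)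
    case (step a b)
    have "reachable (E - F) v b" using step.hyps by (rule reachable_step)
    then have "{a, b} \<in> {e \<in> E. e \<subseteq> C}" using step.hyps by (simp add: C_def)
    then show ?case using step.IH by (rule reachable_step[rotated])
  qed simp
  then have from_v: "reachable {e \<in> E. e \<subseteq> C} v u" if "u \<in> C" for u
    using that by (simp add: C_def)
  have "\<forall>x\<in>C. \<forall>y\<in>C. reachable {e \<in> E. e \<subseteq> C} x y"
    by (intro ballI reachable_trans[OF reachable_sym[OF from_v] from_v])
  moreover have "edge_boundary E C \<subseteq> F"
  proof
    fix e assume "e \<in> edge_boundary E C"
    then obtain x y where e: "e \<in> E" "e = {x, y}" "x \<in> C" "y \<notin> C"
      by (auto simp: boundary_iff)
    then show "e \<in> F" using reachable_step[of "E - F" v x y] by (auto simp: C_def)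
  qed
  moreover have "v \<in> C" by (simp add: C_def)
  ultimately have "region V E C"
    using sub F unfolding region_def by (auto intro: finite_subset)
  then show ?thesis by (simp add: C_def)
qed

text \<open>By \<open>shrinking_regions\<close> such a sequence is itself a countable base at its
  end.\<close>

lemma first_countable_shrinking_regions:
  assumes "\<And>\<omega>. \<omega> \<in> edge_ends V E \<Longrightarrow> \<exists>D :: nat \<Rightarrow> 'v set. (\<forall>i. region V E (D i) \<and> lives \<omega> (D i)) \<and>
      (\<forall>v\<in>V. \<forall>\<^sub>F i in sequentially. v \<notin> D i)"
  shows "first_countable (edge_end_space V E)"
  unfolding first_countable_def topspace_edge_end_space
proof
  fix \<omega> assume \<omega>: "\<omega> \<in> edge_ends V E"
  obtain D :: "nat \<Rightarrow> 'v set" where D: "\<And>i. region V E (D i)" "\<And>i. lives \<omega> (D i)"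
    and van: "\<And>v. v \<in> V \<Longrightarrow> \<forall>\<^sub>F i in sequentially. v \<notin> D i"
    using assms[OF \<omega>] by blast
  let ?O = "\<lambda>i. {\<eta> \<in> edge_ends V E. lives \<eta> (D i)}"
  have "\<exists>W\<in>range ?O. \<omega> \<in> W \<and> W \<subseteq> U" if U: "openin (edge_end_space V E) U" "\<omega> \<in> U" for U
  proof -
    obtain A where A: "finite_cut A" "lives \<omega> A" "\<forall>\<eta>\<in>edge_ends V E. lives \<eta> A \<longrightarrow> \<eta> \<in> U"
      using U unfolding openin_edge_end_space by blast
    obtain i where i: "D i \<subseteq> A"
      using shrinking_regions[of D, OF D(1) van \<omega> D(2) A(1,2)] unfolding eventually_sequentially by blast
    have "?O i \<subseteq> U" using A(3) lives_mono[OF _ i] by blast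
    then show ?thesis using \<omega> D(2) by (intro bexI[of _ "?O i"]) auto
  qed
  moreover have "\<forall>W\<in>range ?O. openin (edge_end_space V E) W"
    using openin_lives[OF region_imp_finite_cut[OF D(1)]] by blast
  ultimately show "\<exists>\<B>. countable \<B> \<and> (\<forall>W\<in>\<B>. openin (edge_end_space V E) W) \<and>
      (\<forall>U. openin (edge_end_space V E) U \<and> \<omega> \<in> U \<longrightarrow> (\<exists>W\<in>\<B>. \<omega> \<in> W \<and> W \<subseteq> U))"
    by (intro exI[of _ "range ?O"]) auto
qed

text \<open>For each edge of a ray take the component beyond it. Every vertex has a finite path to
  \<open>r 0\<close>, which misses almost all edges of the ray; if the vertex lay beyond a missed
  edge, the endpoints of that edge would be joined without it, contrary to
  \<open>acyclic_edge_bridge\<close>.\<close>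

theorem first_countable_acyclic:
  assumes "\<not> has_cycle E"
  shows "first_countable (edge_end_space V E)"
proof (rule first_countable_shrinking_regions)
  fix \<omega> assume "\<omega> \<in> edge_ends V E"
  then obtain r where r: "ray V E r" "\<omega> = end_of r" by (elim endE)
  have rV: "r n \<in> V" and rE: "{r n, r (Suc n)} \<in> E" and rne: "r n \<noteq> r (Suc n)" for n
    using r(1) by (auto simp: ray_def inj_eq)
  define e where "e n = {r n, r (Suc n)}" for n
  have e_inj: "e m = e n \<longleftrightarrow> m = n" for m n
    using ray_edge_eqD[OF r(1)] by (auto simp: e_def)
  have eE: "e n \<in> E" for n using rE by (simp add: e_def)
  define D where "D n = {u. reachable (E - {e n}) (r (Suc n)) u}" for n
  have reg: "region V E (D n)" for n
    unfolding D_def by (rule region_reachable) (use eE rV in auto)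
  have up: "reachable (E - {e n}) (r (Suc n)) (r m)" if "Suc n \<le> m" for n m
    using that
  proof (induction m rule: dec_induct)
    case (step m)
    have "{r m, r (Suc m)} \<in> E - {e n}" using step(1) e_inj[of m n] rE[of m] by (simp add: e_def)
    then show ?case using step reachable_step by fast
  qed simp
  have down: "reachable (E - {e n}) (r 0) (r m)" if "m \<le> n" for n m
    using that
  proof (induction m)
    case (Suc m)
    have "{r m, r (Suc m)} \<in> E - {e n}" using Suc(2) e_inj[of m n] rE[of m] by (simp add: e_def)
    then show ?case using Suc reachable_step by (metis Suc_leD)
  qed simp
  have "lives \<omega> (D n)" for n
    unfolding r(2) lives_end_of[OF r(1) region_imp_finite_cut[OF reg]] eventually_sequentially
    using up by (intro exI[of _ "Suc n"]) (simp add: D_def)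
  moreover have "\<forall>\<^sub>F i in sequentially. v \<notin> D i" if v: "v \<in> V" for v
  proof -
    obtain F where F: "F \<subseteq> E" "finite F" "reachable F v (r 0)"
      using reachable_finite_subset[OF reachable_V[OF v rV]] by blast
    have "inj e" using e_inj by (auto intro: injI)
    then have "finite (e -` F)" using F(2) by (rule finite_vimageI[rotated])
    then obtain N where N: "\<And>n. n \<in> e -` F \<Longrightarrow> n < N"
      using finite_nat_set_iff_bounded by meson
    have "v \<notin> D n" if "n \<ge> N" for n
    proof
      assume "v \<in> D n"
      then have "reachable (E - {e n}) (r (Suc n)) v" by (simp add: D_def)
      moreover have "reachable (E - {e n}) v (r 0)"
        using N[of n] that F(1) by (intro reachable_mono[OF F(3)]) auto
      moreover have "reachable (E - {e n}) (r 0) (r n)" by (rule down) simp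
      ultimately have "reachable (E - {e n}) (r (Suc n)) (r n)" by (meson reachable_trans)
      then show False
        using acyclic_edge_bridge[OF assms rE rne, of n] reachable_sym unfolding e_def by fast
    qed
    then show ?thesis unfolding eventually_sequentially by blast
  qed
  ultimately show "\<exists>D :: nat \<Rightarrow> 'v set. (\<forall>i. region V E (D i) \<and> lives \<omega> (D i)) \<and>
      (\<forall>v\<in>V. \<forall>\<^sub>F i in sequentially. v \<notin> D i)"
    using reg by (intro exI[of _ D]) simp
qed

end

section \<open>Transfer of complete ultrametrics along homeomorphisms\<close>

lemma homeomorphic_completely_ultrametrizable_space:
  fixes X :: "'a topology" and Y :: "'b topology"
  assumes "X homeomorphic_space Y" "completely_ultrametrizable_space Y"
  shows "completely_ultrametrizable_space X"
proof -
  obtain M d where "Metric_space M d" and comp: "Metric_space.mcomplete M d"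
    and ultra: "\<And>x y z. x \<in> M \<Longrightarrow> y \<in> M \<Longrightarrow> z \<in> M \<Longrightarrow> d x z \<le> max (d x y) (d y z)"
    and Y: "Y = Metric_space.mtopology M d"
    using assms(2) unfolding completely_ultrametrizable_space_def by blast
  then interpret Y: Metric_space M d by simp
  obtain f where f: "homeomorphic_map X Y f" using assms(1) homeomorphic_space by blast
  let ?N = "topspace X"
  define e where "e x y = d (f x) (f y)" for x y
  have im: "f ` ?N = M" and inj: "inj_on f ?N"
    using f homeomorphic_imp_surjective_map homeomorphic_imp_injective_map unfolding Y by fastforce+
  have fM: "f x \<in> M" if "x \<in> ?N" for x using im that by blast
  interpret N: Metric_space ?N e
  proof
    show "(e x y = 0) = (x = y)" if "x \<in> ?N" "y \<in> ?N" for x y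
      using that fM inj by (auto simp: e_def inj_on_eq_iff)
    show "e x z \<le> e x y + e y z" if "x \<in> ?N" "y \<in> ?N" "z \<in> ?N" for x y z
      unfolding e_def using that fM by (intro Y.triangle)
  qed (auto simp: e_def Y.commute)
  have ball: "f ` N.mball x r = Y.mball (f x) r" if x: "x \<in> ?N" for x r
  proof (intro equalityI subsetI)
    fix z assume z: "z \<in> Y.mball (f x) r"
    then obtain y where "y \<in> ?N" "z = f y" using im by (auto simp: Y.in_mball)
    then show "z \<in> f ` N.mball x r" using z x by (auto simp: Y.in_mball N.in_mball e_def)
  qed (use x fM in \<open>auto simp: Y.in_mball N.in_mball e_def\<close>)
  have "X = N.mtopology"
    unfolding topology_eq
  proof
    fix U
    show "openin X U \<longleftrightarrow> openin N.mtopology U"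
    proof (cases "U \<subseteq> ?N")
      case True
      have sub: "N.mball x r \<subseteq> U \<longleftrightarrow> Y.mball (f x) r \<subseteq> f ` U" if "x \<in> U" for x r
      proof -
        have "f ` N.mball x r \<subseteq> f ` U \<longleftrightarrow> N.mball x r \<subseteq> U"
          using True by (intro inj_on_image_subset_iff[OF inj]) auto
        moreover have "f ` N.mball x r = Y.mball (f x) r" using ball True that by blast
        ultimately show ?thesis by simp
      qed
      have "openin X U \<longleftrightarrow> openin Y.mtopology (f ` U)"
        using homeomorphic_map_openness_eq[OF f, of U] True by (simp add: Y)
      also have "\<dots> \<longleftrightarrow> openin N.mtopology U"
        unfolding Y.openin_mtopology N.openin_mtopology using True im sub by auto
      finally show ?thesis .
    next
      case False
      then show ?thesis using openin_subset[of X U] openin_subset[of N.mtopology U] by auto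
    qed
  qed
  moreover have "N.mcomplete"
    unfolding N.mcomplete_def
  proof (intro allI impI)
    fix \<sigma> assume \<sigma>: "N.MCauchy \<sigma>"
    then have \<sigma>N: "\<sigma> n \<in> ?N" for n by (auto simp: N.MCauchy_def)
    have "Y.MCauchy (f \<circ> \<sigma>)"
      using \<sigma> fM unfolding N.MCauchy_def Y.MCauchy_def by (auto simp: e_def)
    then obtain l where l: "limitin Y.mtopology (f \<circ> \<sigma>) l sequentially"
      using comp unfolding Y.mcomplete_def by blast
    then obtain p where p: "p \<in> ?N" "l = f p" using im by (auto simp: Y.limitin_metric)
    have "limitin N.mtopology \<sigma> p sequentially"
      using l p \<sigma>N unfolding N.limitin_metric Y.limitin_metric by (simp add: e_def fM)
    then show "\<exists>x. limitin N.mtopology \<sigma> x sequentially" ..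
  qed
  moreover have "e x z \<le> max (e x y) (e y z)" if "x \<in> ?N" "y \<in> ?N" "z \<in> ?N" for x y z
    unfolding e_def using ultra fM that by blast
  ultimately show ?thesis
    unfolding completely_ultrametrizable_space_def using N.Metric_space_axioms by blast
qed

section \<open>Trees from complete ultrametrics\<close>

text \<open>The parts of a refining sequence of partitions, indexed by depth, with a single part at
  depth 0 as the future root. The offset \<open>L\<close> in \<open>c_complete\<close> is there
  because a ray of the tree may begin its final ascent at any level.\<close>

locale nested_partitions =
  fixes X :: "'a topology" and c :: "nat \<Rightarrow> 'a \<Rightarrow> 'a set"
  assumes c_0: "x \<in> topspace X \<Longrightarrow> c 0 x = topspace X"
    and c_self: "x \<in> topspace X \<Longrightarrow> x \<in> c n x"
    and c_sub: "x \<in> topspace X \<Longrightarrow> c n x \<subseteq> topspace X"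
    and c_eq: "x \<in> topspace X \<Longrightarrow> y \<in> c n x \<Longrightarrow> c n y = c n x"
    and c_Suc: "x \<in> topspace X \<Longrightarrow> c (Suc n) x \<subseteq> c n x"
    and c_open: "x \<in> topspace X \<Longrightarrow> openin X (c n x)"
    and c_base: "openin X U \<Longrightarrow> x \<in> U \<Longrightarrow> \<exists>n. c n x \<subseteq> U"
    and c_sep: "x \<in> topspace X \<Longrightarrow> y \<in> topspace X \<Longrightarrow> x \<noteq> y \<Longrightarrow> \<exists>n. y \<notin> c n x"
    and c_complete: "(\<And>i. \<sigma> i \<in> topspace X) \<Longrightarrow> (\<And>i. \<sigma> (Suc i) \<in> c (L + i) (\<sigma> i)) \<Longrightarrow>
       \<exists>p\<in>topspace X. \<forall>i. p \<in> c (L + i) (\<sigma> i)"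
begin

text \<open>The depth is recorded because one set may be a part on many levels, for instance around
  an isolated point; without it the branch of such a point would not be a ray.\<close>

definition node :: "nat \<Rightarrow> 'a \<Rightarrow> nat \<times> 'a set" where
  "node n x = (n, c n x)"

text \<open>The root is added explicitly because it is the only vertex if the space is empty.\<close>

definition tree_verts :: "(nat \<times> 'a set) set" where
  "tree_verts = insert (0, topspace X) {node n x | n x. x \<in> topspace X}"

definition tree_edges :: "(nat \<times> 'a set) set set" where
  "tree_edges = {{node n x, node (Suc n) x} | n x. x \<in> topspace X}"

lemma c_anti: "x \<in> topspace X \<Longrightarrow> m \<le> n \<Longrightarrow> c n x \<subseteq> c m x"
  using c_Suc by (rule lift_Suc_antimono_le)

lemma c_eq_mono:
  assumes x: "x \<in> topspace X" and y: "y \<in> topspace X" and eq: "c n x = c n y" and "m \<le> n"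
  shows "c m x = c m y"
proof -
  have "x \<in> c m y" using c_self[OF x, of n] eq c_anti[OF y \<open>m \<le> n\<close>] by blast
  then show ?thesis by (rule c_eq[OF y])
qed

lemma edgeE:
  assumes "{a, b} \<in> tree_edges"
  obtains n x where "x \<in> topspace X" "a = node n x" "b = node (Suc n) x"
  | n x where "x \<in> topspace X" "b = node n x" "a = node (Suc n) x"
  using assms unfolding tree_edges_def by (auto simp: doubleton_eq_iff)

lemma edgeI: "x \<in> topspace X \<Longrightarrow> {node n x, node (Suc n) x} \<in> tree_edges"
  unfolding tree_edges_def by blast

lemma edge_level: "{a, b} \<in> tree_edges \<Longrightarrow> fst b = Suc (fst a) \<or> fst a = Suc (fst b)"
  by (erule edgeE) (auto simp: node_def)

lemma edge_upE:
  assumes "{a, b} \<in> tree_edges" "fst a < fst b"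
  obtains n x where "x \<in> topspace X" "a = node n x" "b = node (Suc n) x"
  using assms by (elim edgeE) (auto simp: node_def)

text \<open>Parts that agree at one depth agree at all smaller ones. Together with
  \<open>edge_level\<close> this settles acyclicity and the shape of rays.\<close>

lemma unique_parent:
  assumes "{a, b} \<in> tree_edges" "{a', b} \<in> tree_edges" "fst a < fst b" "fst a' < fst b"
  shows "a = a'"
proof -
  obtain n x where x: "x \<in> topspace X" "a = node n x" "b = node (Suc n) x"
    using assms(1,3) by (rule edge_upE)
  obtain m y where y: "y \<in> topspace X" "a' = node m y" "b = node (Suc m) y"
    using assms(2,4) by (rule edge_upE)
  have "m = n" "c (Suc n) x = c (Suc n) y" using x y by (auto simp: node_def)
  then show ?thesis using x y c_eq_mono[of x y "Suc n" n] by (simp add: node_def)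
qed

lemma node_in: "x \<in> topspace X \<Longrightarrow> node n x \<in> tree_verts"
  by (auto simp: tree_verts_def)

lemma root_reachable:
  assumes "x \<in> topspace X"
  shows "reachable tree_edges (0, topspace X) (node n x)"
proof (induction n)
  case 0
  then show ?case using assms by (simp add: node_def c_0)
next
  case (Suc n)
  then show ?case using edgeI[OF assms] by (rule reachable_step)
qed

lemma connected_tree: "connected_graph tree_verts tree_edges"
proof -
  have "graph tree_verts tree_edges"
    unfolding graph_def
  proof
    fix e assume "e \<in> tree_edges"
    then obtain n x where "x \<in> topspace X" "e = {node n x, node (Suc n) x}"
      by (auto simp: tree_edges_def)
    then show "\<exists>x y. x \<noteq> y \<and> e = {x, y} \<and> x \<in> tree_verts \<and> y \<in> tree_verts"
      using node_in by (intro exI[of _ "node n x"] exI[of _ "node (Suc n) x"]) (simp add: node_def)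
  qed
  moreover have "reachable tree_edges (0, topspace X) v" if "v \<in> tree_verts" for v
    using that root_reachable by (auto simp: tree_verts_def)
  then have "\<forall>u\<in>tree_verts. \<forall>v\<in>tree_verts. reachable tree_edges u v"
    by (meson reachable_sym reachable_trans)
  moreover have "tree_verts \<noteq> {}" by (auto simp: tree_verts_def)
  ultimately show ?thesis by (simp add: connected_graph_def)
qed

text \<open>Both neighbours of a vertex of maximal level on a cycle are parents of it and hence
  coincide.\<close>

lemma acyclic_tree: "\<not> has_cycle tree_edges"
proof
  assume "has_cycle tree_edges"
  then obtain xs where len: "length xs \<ge> 3" and dist: "distinct xs" and w: "walk tree_edges xs"
    and cl: "{last xs, hd xs} \<in> tree_edges"
    unfolding has_cycle_def by blast
  let ?n = "length xs"
  have ne: "xs \<noteq> []" using len by auto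
  have adj: "{xs ! i, xs ! (Suc i mod ?n)} \<in> tree_edges" if "i < ?n" for i
  proof (cases "Suc i < ?n")
    case True
    then show ?thesis using w by (simp add: walk_def)
  next
    case False
    then have "Suc i = ?n" "i = ?n - 1" using that by simp_all
    then show ?thesis using cl ne by (simp add: last_conv_nth hd_conv_nth)
  qed
  obtain j where j: "j < ?n" and max: "\<And>i. i < ?n \<Longrightarrow> fst (xs ! i) \<le> fst (xs ! j)"
  proof -
    have "\<exists>j. j < ?n \<and> (\<forall>i. i < ?n \<longrightarrow> fst (xs ! i) \<le> fst (xs ! j))"
    proof -
      have "finite ((\<lambda>i. fst (xs ! i)) ` {..<?n})" "(\<lambda>i. fst (xs ! i)) ` {..<?n} \<noteq> {}"
        using ne by auto
      then have "Max ((\<lambda>i. fst (xs ! i)) ` {..<?n}) \<in> (\<lambda>i. fst (xs ! i)) ` {..<?n}"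
        by (rule Max_in)
      then obtain j where j: "j < ?n" "Max ((\<lambda>i. fst (xs ! i)) ` {..<?n}) = fst (xs ! j)" by auto
      have "fst (xs ! i) \<le> fst (xs ! j)" if "i < ?n" for i
        unfolding j(2)[symmetric] using that by (intro Max_ge) auto
      then show ?thesis using j(1) by blast
    qed
    then show ?thesis using that by blast
  qed
  \<comment> \<open>Cyclic successor and predecessor of \<open>j\<close>; they differ because the
    cycle has at least three vertices.\<close>
  define a where "a = Suc j mod ?n"
  define b where "b = (if j = 0 then ?n - 1 else j - 1)"
  have ab: "a < ?n" "b < ?n" "a \<noteq> b" "Suc b mod ?n = j"
    using j len by (auto simp: a_def b_def mod_Suc)
  have "{xs ! a, xs ! j} \<in> tree_edges" using adj[OF j] by (simp add: a_def insert_commute)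
  moreover have "{xs ! b, xs ! j} \<in> tree_edges" using adj[OF ab(2)] ab(4) by simp
  moreover have "fst (xs ! a) < fst (xs ! j)"
    using edge_level[OF calculation(1)] max[OF ab(1)] by linarith
  moreover have "fst (xs ! b) < fst (xs ! j)"
    using edge_level[OF calculation(2)] max[OF ab(2)] by linarith
  ultimately have "xs ! a = xs ! b" by (rule unique_parent)
  then show False using dist ab by (simp add: nth_eq_iff_index_eq)
qed

interpretation T: conn_graph tree_verts tree_edges
  by unfold_locales (rule connected_tree)

abbreviation tree_end :: "'a \<Rightarrow> (nat \<Rightarrow> nat \<times> 'a set) set" where
  "tree_end x \<equiv> T.end_of (\<lambda>n. node n x)"

lemma ray_node: "x \<in> topspace X \<Longrightarrow> ray tree_verts tree_edges (\<lambda>n. node n x)"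
  by (auto simp: ray_def node_in edgeI inj_def) (simp add: node_def)

definition subtree :: "nat \<Rightarrow> 'a \<Rightarrow> (nat \<times> 'a set) set" where
  "subtree n x = {node m y | m y. n \<le> m \<and> y \<in> c n x}"

lemma node_in_subtree:
  assumes x: "x \<in> topspace X" and y: "y \<in> topspace X"
  shows "node m y \<in> subtree n x \<longleftrightarrow> n \<le> m \<and> y \<in> c n x"
proof
  assume "node m y \<in> subtree n x"
  then obtain y' where y': "n \<le> m" "y' \<in> c n x" "c m y = c m y'"
    by (auto simp: subtree_def node_def)
  have "y' \<in> topspace X" using y'(2) c_sub[OF x] by blast
  then have "c n y = c n y'" using c_eq_mono[OF y _ y'(3,1)] by blast
  then show "n \<le> m \<and> y \<in> c n x" using y' c_eq[OF x y'(2)] c_self[OF y, of n] by simp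
qed (auto simp: subtree_def)

text \<open>The subtree is connected through its top node, and only the edge to the parent of that
  node can leave it.\<close>

lemma region_subtree:
  assumes x: "x \<in> topspace X"
  shows "region tree_verts tree_edges (subtree n x)"
proof -
  let ?C = "subtree n x"
  have sub: "y \<in> topspace X" if "y \<in> c n x" for y using that c_sub[OF x] by blast
  have "reachable {e \<in> tree_edges. e \<subseteq> ?C} (node n x) (node m y)" if "n \<le> m" "y \<in> c n x" for m y
    using that(1)
  proof (induction m rule: dec_induct)
    case base
    have "node n y = node n x" using c_eq[OF x that(2)] by (simp add: node_def)
    then show ?case by simp
  next
    case (step m)
    have "{node m y, node (Suc m) y} \<in> {e \<in> tree_edges. e \<subseteq> ?C}"
      using edgeI[OF sub[OF that(2)]] node_in_subtree[OF x sub[OF that(2)]] step that(2) by auto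
    then show ?case using step.IH by (rule reachable_step[rotated])
  qed
  then have from_x: "reachable {e \<in> tree_edges. e \<subseteq> ?C} (node n x) u" if "u \<in> ?C" for u
    using that by (auto simp: subtree_def)
  have conn: "\<forall>u\<in>?C. \<forall>v\<in>?C. reachable {e \<in> tree_edges. e \<subseteq> ?C} u v"
    by (intro ballI reachable_trans[OF reachable_sym[OF from_x] from_x])
  \<comment> \<open>The truncated difference is harmless for \<open>n = 0\<close>: a boundary edge
    forces \<open>n = Suc m\<close>, so the boundary is then empty.\<close>
  have "edge_boundary tree_edges ?C \<subseteq> {{node (n - 1) x, node n x}}"
  proof
    fix e assume e: "e \<in> edge_boundary tree_edges ?C"
    then obtain m y where y: "y \<in> topspace X" "e = {node m y, node (Suc m) y}"
      by (auto simp: edge_boundary_def tree_edges_def)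
    have "(node m y \<in> ?C) \<noteq> (node (Suc m) y \<in> ?C)"
      using e y(2) by (auto simp: edge_boundary_def)
    then have n: "n = Suc m" "y \<in> c n x" using node_in_subtree[OF x y(1)] by auto
    have "c n y = c n x" using c_eq[OF x n(2)] .
    moreover from this have "c m y = c m x" using c_eq_mono[OF y(1) x, of n m] n(1) by simp
    ultimately show "e \<in> {{node (n - 1) x, node n x}}" using y(2) n(1) by (simp add: node_def)
  qed
  then have "finite (edge_boundary tree_edges ?C)" by (rule finite_subset) simp
  moreover have "?C \<subseteq> tree_verts" using node_in sub by (auto simp: subtree_def)
  moreover have "node n x \<in> ?C" using node_in_subtree[OF x x] c_self[OF x] by simp
  ultimately show ?thesis using conn unfolding region_def by blast
qed

lemma lives_subtree:
  assumes x: "x \<in> topspace X" and y: "y \<in> topspace X"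
  shows "T.lives (tree_end y) (subtree n x) \<longleftrightarrow> y \<in> c n x"
proof -
  have "T.lives (tree_end y) (subtree n x) \<longleftrightarrow> (\<forall>\<^sub>F m in sequentially. node m y \<in> subtree n x)"
    by (rule T.lives_end_of[OF ray_node[OF y] T.region_imp_finite_cut[OF region_subtree[OF x]]])
  also have "\<dots> \<longleftrightarrow> y \<in> c n x"
    unfolding node_in_subtree[OF x y] eventually_sequentially by auto
  finally show ?thesis .
qed

text \<open>A descent right after an ascent would return to the unique parent just left, which
  injectivity forbids, and a ray cannot descend forever. So it ascends from its first ascent
  on.\<close>

lemma ray_ascends:
  assumes r: "ray tree_verts tree_edges r"
  shows "\<exists>N. \<forall>n\<ge>N. fst (r (Suc n)) = Suc (fst (r n))"
proof -
  have rE: "{r n, r (Suc n)} \<in> tree_edges" and inj: "inj r" for n using r by (auto simp: ray_def)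
  have stay: "fst (r (Suc (Suc n))) = Suc (fst (r (Suc n)))" if "fst (r (Suc n)) = Suc (fst (r n))" for n
  proof (rule ccontr)
    assume "\<not> ?thesis"
    then have "fst (r (Suc (Suc n))) < fst (r (Suc n))" using edge_level[OF rE[of "Suc n"]] by linarith
    moreover have "{r (Suc (Suc n)), r (Suc n)} \<in> tree_edges"
      using rE[of "Suc n"] by (simp add: insert_commute)
    ultimately have "r n = r (Suc (Suc n))" using unique_parent[OF rE[of n]] that by simp
    then show False using injD[OF inj] by fastforce
  qed
  have "\<exists>N. fst (r (Suc N)) = Suc (fst (r N))"
  proof (rule ccontr)
    assume no: "\<not> ?thesis"
    have "fst (r n) + n = fst (r 0)" for n
    proof (induction n)
      case (Suc n)
      then show ?case using edge_level[OF rE[of n]] no by auto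
    qed simp
    from this[of "Suc (fst (r 0))"] show False by simp
  qed
  then obtain N where N: "fst (r (Suc N)) = Suc (fst (r N))" by blast
  have "fst (r (Suc n)) = Suc (fst (r n))" if "n \<ge> N" for n
    using that by (induction n rule: dec_induct) (use N stay in auto)
  then show ?thesis by blast
qed

text \<open>From level \<open>L\<close> on the ray passes through nested parts. Completeness gives a
  point \<open>p\<close> in all of them, and the ray shares a tail with the branch of
  \<open>p\<close>.\<close>

lemma ray_tree_end:
  assumes r: "ray tree_verts tree_edges r"
  shows "\<exists>x\<in>topspace X. T.end_of r = tree_end x"
proof -
  obtain N where N: "\<And>n. n \<ge> N \<Longrightarrow> fst (r (Suc n)) = Suc (fst (r n))" using ray_ascends[OF r] by blast
  define L where "L = fst (r N)"
  have lev: "fst (r (N + i)) = L + i" for i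
    by (induction i) (use N in \<open>auto simp: L_def\<close>)
  have "\<exists>x. x \<in> topspace X \<and> r (N + i) = node (L + i) x \<and> r (N + Suc i) = node (L + Suc i) x" for i
  proof -
    have "{r (N + i), r (N + Suc i)} \<in> tree_edges" using r by (simp add: ray_def)
    moreover have "fst (r (N + i)) < fst (r (N + Suc i))" unfolding lev by simp
    ultimately obtain n x where x: "x \<in> topspace X" "r (N + i) = node n x" "r (N + Suc i) = node (Suc n) x"
      by (rule edge_upE)
    then have "n = L + i" using lev[of i] by (simp add: node_def)
    then show ?thesis using x by auto
  qed
  then obtain x where x: "\<And>i. x i \<in> topspace X" "\<And>i. r (N + i) = node (L + i) (x i)"
      "\<And>i. r (N + Suc i) = node (L + Suc i) (x i)"
    by metis
  have "x (Suc i) \<in> c (L + i) (x i)" for i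
  proof -
    have "c (L + Suc i) (x (Suc i)) = c (L + Suc i) (x i)"
      using x(2)[of "Suc i"] x(3)[of i] by (simp add: node_def)
    then have "c (L + i) (x (Suc i)) = c (L + i) (x i)"
      using c_eq_mono[OF x(1) x(1), of "L + Suc i" "Suc i" i "L + i"] by simp
    then show ?thesis using c_self[OF x(1), of "Suc i" "L + i"] by simp
  qed
  then obtain p where p: "p \<in> topspace X" "\<And>i. p \<in> c (L + i) (x i)" using c_complete[of x L, OF x(1)] by blast
  have "r (i + N) = node (i + L) p" for i
    using x(2)[of i] c_eq[OF x(1) p(2), of i] by (simp add: node_def add.commute)
  then have "T.end_of r = tree_end p" by (rule T.end_of_eqI[OF r ray_node[OF p(1)]])
  then show ?thesis using p(1) by blast
qed

lemma bij_tree_end: "bij_betw tree_end (topspace X) (edge_ends tree_verts tree_edges)"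
  unfolding bij_betw_def
proof
  show "inj_on tree_end (topspace X)"
  proof (rule inj_onI, rule ccontr)
    fix x y assume xy: "x \<in> topspace X" "y \<in> topspace X" "tree_end x = tree_end y" "x \<noteq> y"
    then obtain n where "y \<notin> c n x" using c_sep by blast
    then show False using lives_subtree[OF xy(1,1), of n] lives_subtree[OF xy(1,2), of n] xy c_self by simp
  qed
  show "tree_end ` topspace X = edge_ends tree_verts tree_edges"
    unfolding T.edge_ends_eq
  proof (intro equalityI subsetI)
    fix \<omega> assume "\<omega> \<in> T.end_of ` {r. ray tree_verts tree_edges r}"
    then obtain r where "ray tree_verts tree_edges r" "\<omega> = T.end_of r" by blast
    then show "\<omega> \<in> tree_end ` topspace X" using ray_tree_end by blast
  qed (use ray_node in blast)
qed

text \<open>Ends living in \<open>subtree n x\<close> correspond to the points of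
  \<open>c n x\<close>. In the other direction, the subtrees along a branch leave every vertex
  behind, so \<open>shrinking_regions\<close> fits one of them into any cut around the end.\<close>

lemma tree_end_openin:
  assumes U: "U \<subseteq> topspace X"
  shows "openin X U \<longleftrightarrow> openin (edge_end_space tree_verts tree_edges) (tree_end ` U)"
proof
  have im: "tree_end ` topspace X = edge_ends tree_verts tree_edges"
    and inj: "inj_on tree_end (topspace X)"
    using bij_tree_end by (auto simp: bij_betw_def)
  {
    assume op: "openin X U"
    show "openin (edge_end_space tree_verts tree_edges) (tree_end ` U)"
      unfolding T.openin_edge_end_space
    proof (intro conjI ballI)
      show "tree_end ` U \<subseteq> edge_ends tree_verts tree_edges" using U im by blast
      fix \<omega> assume "\<omega> \<in> tree_end ` U"
      then obtain x where x: "x \<in> U" "\<omega> = tree_end x" by blast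
      have xM: "x \<in> topspace X" using x U by blast
      obtain n where n: "c n x \<subseteq> U" using c_base[OF op x(1)] by blast
      have "\<eta> \<in> tree_end ` U" if \<eta>: "\<eta> \<in> edge_ends tree_verts tree_edges" "T.lives \<eta> (subtree n x)" for \<eta>
      proof -
        obtain y where y: "y \<in> topspace X" "\<eta> = tree_end y" using \<eta>(1) im by blast
        then have "y \<in> c n x" using \<eta>(2) lives_subtree[OF xM] by simp
        then show ?thesis using y n by blast
      qed
      moreover have "T.lives \<omega> (subtree n x)"
        unfolding x(2) using lives_subtree[OF xM xM] c_self[OF xM] by simp
      ultimately show "\<exists>A. T.finite_cut A \<and> T.lives \<omega> A \<and>
          (\<forall>\<eta>\<in>edge_ends tree_verts tree_edges. T.lives \<eta> A \<longrightarrow> \<eta> \<in> tree_end ` U)"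
        using T.region_imp_finite_cut[OF region_subtree[OF xM, of n]]
        by (intro exI[of _ "subtree n x"]) simp
    qed
  }
  assume op: "openin (edge_end_space tree_verts tree_edges) (tree_end ` U)"
  show "openin X U"
  proof (subst openin_subopen, intro ballI)
    fix x assume x: "x \<in> U"
    then have xM: "x \<in> topspace X" using U by blast
    then have en: "tree_end x \<in> edge_ends tree_verts tree_edges" using im by blast
    obtain A where A: "T.finite_cut A" "T.lives (tree_end x) A"
        "\<forall>\<eta>\<in>edge_ends tree_verts tree_edges. T.lives \<eta> A \<longrightarrow> \<eta> \<in> tree_end ` U"
      using op x unfolding T.openin_edge_end_space by blast
    \<comment> \<open>A node belongs to no subtree whose top lies on a deeper level.\<close>
    have van: "\<forall>\<^sub>F i in sequentially. v \<notin> subtree i x" for v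
      unfolding eventually_sequentially
      by (intro exI[of _ "Suc (fst v)"]) (auto simp: subtree_def node_def)
    have liv: "T.lives (tree_end x) (subtree i x)" for i
      using lives_subtree[OF xM xM] c_self[OF xM] by simp
    obtain n where n: "subtree n x \<subseteq> A"
      using T.shrinking_regions[of "\<lambda>i. subtree i x", OF region_subtree[OF xM] van en liv A(1,2)]
      unfolding eventually_sequentially by blast
    have "c n x \<subseteq> U"
    proof
      fix y assume y: "y \<in> c n x"
      then have yM: "y \<in> topspace X" using c_sub[OF xM] by blast
      then have "T.lives (tree_end y) A" using T.lives_mono[OF _ n] lives_subtree[OF xM] y by blast
      then have "tree_end y \<in> tree_end ` U" using A(3) im yM by blast
      then show "y \<in> U" using inj_on_image_mem_iff[OF inj yM U] by blast
    qed
    then show "\<exists>W. openin X W \<and> x \<in> W \<and> W \<subseteq> U"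
      using c_open[OF xM, of n] c_self[OF xM, of n] by blast
  qed
qed

theorem homeomorphic_tree:
  "tree tree_verts tree_edges \<and> X homeomorphic_space edge_end_space tree_verts tree_edges"
proof
  show "tree tree_verts tree_edges" using connected_tree acyclic_tree by (simp add: tree_def)
  let ?Y = "edge_end_space tree_verts tree_edges"
  have im: "tree_end ` topspace X = topspace ?Y" and inj: "inj_on tree_end (topspace X)"
    using bij_tree_end by (auto simp: bij_betw_def)
  have "homeomorphic_map X ?Y tree_end"
  proof (rule bijective_open_imp_homeomorphic_map[OF _ _ im inj])
    show "open_map X ?Y tree_end"
      unfolding open_map_def using tree_end_openin openin_subset by blast
    show "continuous_map X ?Y tree_end"
      unfolding continuous_map
    proof (intro conjI allI impI)
      show "tree_end ` topspace X \<subseteq> topspace ?Y" using im by simp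
      fix U assume U: "openin ?Y U"
      then have "U \<subseteq> tree_end ` topspace X" unfolding im by (rule openin_subset)
      then have "tree_end ` {x \<in> topspace X. tree_end x \<in> U} = U" by blast
      then show "openin X {x \<in> topspace X. tree_end x \<in> U}"
        using U tree_end_openin[of "{x \<in> topspace X. tree_end x \<in> U}"] by simp
    qed
  qed
  then show "X homeomorphic_space ?Y" using homeomorphic_map_imp_homeomorphic_space by blast
qed

end

text \<open>In an ultrametric every point of a ball is a centre of it, so the balls of one radius
  partition the space.\<close>

lemma completely_ultrametrizable_imp_tree:
  fixes X :: "'a topology"
  assumes "completely_ultrametrizable_space X"
  shows "\<exists>(TV :: (nat \<times> 'a set) set) TE. tree TV TE \<and> X homeomorphic_space edge_end_space TV TE"
proof -
  obtain M d where "Metric_space M d" and comp: "Metric_space.mcomplete M d"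
    and ultra: "\<And>x y z. x \<in> M \<Longrightarrow> y \<in> M \<Longrightarrow> z \<in> M \<Longrightarrow> d x z \<le> max (d x y) (d y z)"
    and X: "X = Metric_space.mtopology M d"
    using assms unfolding completely_ultrametrizable_space_def by blast
  then interpret Metric_space M d by simp
  \<comment> \<open>Depth 0 is the whole space, as distances may be unbounded and the tree needs a
    single root.\<close>
  define c where "c n x = (if n = 0 then M else mball x ((1/2) ^ n))" for n :: nat and x
  have M: "topspace X = M" by (simp add: X)
  have mem: "y \<in> c n x \<longleftrightarrow> y \<in> M \<and> (n = 0 \<or> d x y < (1/2) ^ n)" if "x \<in> M" for x y n
    using that by (simp add: c_def in_mball)
  have small: "\<exists>n. (1/2::real) ^ n < e" if "e > 0" for e
    using that by (intro real_arch_pow_inv) auto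
  have eq: "c n y = c n x" if x: "x \<in> M" and y: "y \<in> c n x" for n x y
  proof -
    have yM: "y \<in> M" and xy: "n = 0 \<or> d x y < (1/2) ^ n" using mem[OF x] y by auto
    have "n = 0 \<or> d y z < (1/2) ^ n \<longleftrightarrow> n = 0 \<or> d x z < (1/2) ^ n" if "z \<in> M" for z
      using ultra[OF yM x that] ultra[OF x yM that] xy commute[of x y] by auto
    then show ?thesis using mem[OF x] mem[OF yM] by blast
  qed
  have "nested_partitions X c"
  proof (unfold_locales, unfold M)
    show "c 0 x = M" for x by (simp add: c_def)
    show self: "x \<in> c n x" if "x \<in> M" for x n using mem that by simp
    show "c n x \<subseteq> M" if "x \<in> M" for x n using mem that by blast
    show "c n y = c n x" if "x \<in> M" "y \<in> c n x" for x y n using eq that .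
    show dec: "c (Suc n) x \<subseteq> c n x" if "x \<in> M" for x n
    proof
      fix y assume y: "y \<in> c (Suc n) x"
      have "d x y < (1/2) ^ Suc n" "y \<in> M" using y mem[OF that] by auto
      moreover have "(1/2::real) ^ Suc n \<le> (1/2) ^ n" by simp
      ultimately show "y \<in> c n x" unfolding mem[OF that] by linarith
    qed
    show "openin X (c n x)" for x n
      by (simp add: c_def X)
    show "\<exists>n. c n x \<subseteq> U" if U: "openin X U" "x \<in> U" for x U
    proof -
      obtain r where r: "r > 0" "mball x r \<subseteq> U" using U unfolding X openin_mtopology by blast
      obtain n where n: "(1/2::real) ^ n < r" using small r by blast
      have "(1/2::real) ^ Suc n \<le> (1/2) ^ n" by simp
      then have "mball x ((1/2) ^ Suc n) \<subseteq> mball x r" using n by (intro mball_subset_concentric) linarith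
      then show ?thesis using r by (intro exI[of _ "Suc n"]) (auto simp: c_def)
    qed
    show "\<exists>n. y \<notin> c n x" if "x \<in> M" "y \<in> M" "x \<noteq> y" for x y
    proof -
      have "d x y > 0" using that by simp
      then obtain n where n: "(1/2::real) ^ n < d x y" using small by blast
      have "(1/2::real) ^ Suc n \<le> (1/2) ^ n" by simp
      then have "y \<notin> c (Suc n) x" unfolding mem[OF that(1)] using n by linarith
      then show ?thesis by blast
    qed
    fix x :: "nat \<Rightarrow> 'a" and L assume x: "\<And>i. x i \<in> M" and st: "\<And>i. x (Suc i) \<in> c (L + i) (x i)"
    have anti: "c n y \<subseteq> c m y" if "m \<le> n" "y \<in> M" for m n y
      using dec[OF that(2)] that(1) by (rule lift_Suc_antimono_le)
    have later: "x j \<in> c (L + i) (x i)" if "i \<le> j" for i j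
      using that
    proof (induction j rule: dec_induct)
      case base
      then show ?case using self x by simp
    next
      case (step j)
      have "x (Suc j) \<in> c (L + i) (x j)" using st[of j] anti[of "L + i" "L + j"] x step(1) by auto
      then show ?case using eq[OF x step(3)] by simp
    qed
    \<comment> \<open>Starting at \<open>Suc k\<close> keeps the depth positive, where membership in
      a part really bounds the distance.\<close>
    have close: "d (x i) (x j) < (1/2) ^ k" if "Suc k \<le> i" "Suc k \<le> j" for i j k
    proof -
      have "x i \<in> c (L + Suc k) (x (Suc k))" "x j \<in> c (L + Suc k) (x (Suc k))"
        by (rule later[OF that(1)], rule later[OF that(2)])
      then have "x j \<in> c (L + Suc k) (x i)" using eq[OF x] by blast
      then have "d (x i) (x j) < (1/2) ^ (L + Suc k)" using mem[OF x] by simp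
      also have "\<dots> \<le> (1/2) ^ k" by (intro power_decreasing) auto
      finally show ?thesis .
    qed
    have "MCauchy x"
      unfolding MCauchy_def
    proof (intro conjI allI impI)
      show "range x \<subseteq> M" using x by blast
      fix \<epsilon> :: real assume "\<epsilon> > 0"
      then obtain k where k: "(1/2::real) ^ k < \<epsilon>" using small by blast
      then show "\<exists>N. \<forall>n n'. N \<le> n \<longrightarrow> N \<le> n' \<longrightarrow> d (x n) (x n') < \<epsilon>"
        using close[of k] by (intro exI[of _ "Suc k"]) (meson less_trans)
    qed
    then obtain p where p: "limitin mtopology x p sequentially" using comp unfolding mcomplete_def by blast
    then have pM: "p \<in> M" by (simp add: limitin_metric)
    have "p \<in> c (L + i) (x i)" for i
    proof -
      have "\<forall>\<^sub>F j in sequentially. x j \<in> M \<and> d (x j) p < (1/2) ^ (L + i)"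
        using p unfolding limitin_metric by simp
      then obtain K where K: "\<And>j. j \<ge> K \<Longrightarrow> d (x j) p < (1/2) ^ (L + i)"
        unfolding eventually_sequentially by blast
      \<comment> \<open>The limit lies in the part of a late term, which by \<open>later\<close> is
        also the part of \<open>x i\<close>.\<close>
      have "p \<in> c (L + i) (x (max K i))" using K[of "max K i"] mem[OF x] pM by simp
      then show ?thesis using eq[OF x later[of i "max K i"]] by simp
    qed
    then show "\<exists>p\<in>M. \<forall>i. p \<in> c (L + i) (x i)" using pM by blast
  qed
  then show ?thesis using nested_partitions.homeomorphic_tree by blast
qed

lemma tree_imp_first_countable:
  assumes "tree TV TE" "X homeomorphic_space edge_end_space TV TE"
  shows "first_countable X"
proof -
  interpret conn_graph TV TE
    using assms(1) by unfold_locales (simp add: tree_def)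
  have "first_countable (edge_end_space TV TE)"
    using assms(1) by (intro first_countable_acyclic) (simp add: tree_def)
  then show ?thesis using homeomorphic_space_first_countability[OF assms(2)] by simp
qed

text \<open>A formula cannot quantify over the vertex type of the tree. The tree condition therefore
  appears twice: as an equivalence for one concrete type that always suffices, and as an implication
  for trees over an arbitrary type.\<close>

theorem theorem1p1:
  fixes X :: "'a topology" and V :: "'v set" and E :: "'v set set"
  assumes "connected_graph V E"
    and "X homeomorphic_space edge_end_space V E"
  shows "(first_countable X \<longleftrightarrow> metrizable_space X)
       \<and> (metrizable_space X \<longleftrightarrow> completely_ultrametrizable_space X)
       \<and> (completely_ultrametrizable_space X \<longleftrightarrow>
            (\<exists>(TV :: (nat \<times> 'a set) set) TE. tree TV TE \<and>
                X homeomorphic_space edge_end_space TV TE))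
       \<and> (\<forall>(TV :: 'w set) TE. tree TV TE \<and> X homeomorphic_space edge_end_space TV TE
            \<longrightarrow> first_countable X)"
proof -
  have cu: "completely_ultrametrizable_space X" if "first_countable X"
  proof -
    interpret G: conn_graph V E by unfold_locales (rule assms)
    have "first_countable (edge_end_space V E)"
      using homeomorphic_space_first_countability[OF assms(2)] that by simp
    then show ?thesis
      using homeomorphic_completely_ultrametrizable_space[OF assms(2)]
        G.first_countable_imp_completely_ultrametrizable by blast
  qed
  have mt: "metrizable_space X" if "completely_ultrametrizable_space X"
    using that unfolding completely_ultrametrizable_space_def metrizable_space_def by blast
  have mf: "first_countable X" if "metrizable_space X"
    using that by (rule metrizable_imp_first_countable)
  show ?thesis
  proof (intro conjI iffI allI impI)
    assume "\<exists>(TV :: (nat \<times> 'a set) set) TE. tree TV TE \<and> X homeomorphic_space edge_end_space TV TE"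
    then show "completely_ultrametrizable_space X" using cu tree_imp_first_countable by blast
  next
    fix TV :: "'w set" and TE
    assume "tree TV TE \<and> X homeomorphic_space edge_end_space TV TE"
    then show "first_countable X" using tree_imp_first_countable by blast
  qed (use cu mt mf completely_ultrametrizable_imp_tree in simp_all)
qed

end
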